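(* Let $K$ be a field of characteristic zero. The standard generic bialgebras $\mathbf{QSh}^g_d$ and $\mathbf{Sh}^g$ (over the alphabet $\mathbb N^\ast$ with trivial partition) are isomorphic under the linear map $\psi$ given by $\psi(\emptyset)=\emptyset$ and, for pairwise distinct $n_1,\dots,n_k\in\mathbb N^\ast$ ($k\ge1$), $$\psi([n_1\dots n_k])=\sum_{\mu_1+\dots+\mu_r=k}\frac{(-1)^{k-r}}{\mu_1\cdots\mu_r}\;Q_1Q_2\cdots Q_r,\qquad Q_s=\sum_{j=M_{s-1}+1}^{M_s}\frac{[n_j]}{\prod_{l\ne j,\ M_{s-1}+1\le l\le M_s}(n_j-n_l)},$$ where the sum runs over all $r\ge1$ and positive integers $\mu_1,\dots,\mu_r$ with sum $k$, $M_0=0$, $M_s=\mu_1+\dots+\mu_s$, and $Q_1\cdots Q_r$ is the (multilinear) concatenation product of words.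
   Context: All spaces are over $K$; $\mathbb N^\ast$ is the set of positive integers, viewed as an alphabet with the trivial partition (blocks are singletons). A tensor product of words over $\mathbb N^\ast$ is generic if no letter appears twice overall; generic words are in generic position if their tensor product is generic. Generic structures are structures in the symmetric monoidal linear category $\mathbf{Gen}_{\mathbb N^\ast}$ whose objects are direct sums of one-dimensional spaces $V_t$ spanned by generic tensor products of words $t$, whose morphisms are generated linearly (and under composition) by the maps regrouping the tensor factors while keeping the underlying concatenated word, the maps erasing letters, and the symmetry maps $V_{t\otimes t'}\to V_{t'\otimes t}$, and whose tensor product is $V_t\hat\otimes V_{t'}=V_{t\otimes t'}$ if $t\otimes t'$ is generic and $0$ otherwise, extended distributively to direct sums. In particular products in generic bialgebras are defined only on pairs of elements in generic position. A generic bialgebra $H$ is standard if $H=\bigoplus_{n\ge0}H_n$ with $H_0=V_\emptyset\cong K$, where $\emptyset$ is the unit/counit, the coproduct is graded, and for $p,q>0$ the product maps $H_p\hat\otimes H_q$ into $\bigoplus_{0<n\le p+q}H_n$. An isomorphism of generic bialgebras is an isomorphism in $\mathbf{Gen}_{\mathbb N^\ast}$ compatible with units, counits, products (on elements in generic position) and coproducts. $T^g(\mathbb N^\ast)$ is the span of all generic words $[n_1\dots n_k]$ (graded by length), with deconcatenation coproduct $\Delta([n_1\dots n_k])=\sum_{i=0}^k[n_1\dots n_i]\otimes[n_{i+1}\dots n_k]$. $\mathbf{Sh}^g$ is $T^g(\mathbb N^\ast)$ with this coproduct and the shuffle product of words in generic position. $\mathbf{QSh}^g_d$ is $T^g(\mathbb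 N^\ast)$ with this coproduct and the product $\overline\star$ with unit $\emptyset$ defined recursively (for words in generic position) by $$[n_1\dots n_k]\,\overline\star\,[m_1\dots m_l]=[n_1(n_2\dots n_k\,\overline\star\,m_1\dots m_l)]+[m_1(n_1\dots n_k\,\overline\star\,m_2\dots m_l)]$$ $$+\frac1{n_1-m_1}\big\{[n_1(n_2\dots n_k\,\overline\star\,m_2\dots m_l)]-[m_1(n_2\dots n_k\,\overline\star\,m_2\dots m_l)]\big\},$$ where $[n(w)]$ denotes concatenation of the letter $n$ in front of $w$. *)

theory Defs
  imports Complex_Main "HOL-Library.Poly_Mapping"
begin

text \<open>
  A vector space with a chosen basis indexed by (a subset of) \<open>'i\<close> is represented inside
  \<open>'i \<Rightarrow>\<^sub>0 'k\<close>; the basis vector of index \<open>i\<close> is \<open>single i 1\<close>.  A linear map is represented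
  by its values on basis vectors, and \<open>lin f\<close> is its linear extension.
\<close>

definition scale :: "'k::comm_ring_1 \<Rightarrow> ('i \<Rightarrow>\<^sub>0 'k) \<Rightarrow> ('i \<Rightarrow>\<^sub>0 'k)" where
  "scale c p = Poly_Mapping.map (\<lambda>x. c * x) p"

definition lin :: "('i \<Rightarrow> ('j \<Rightarrow>\<^sub>0 'k::comm_ring_1)) \<Rightarrow> ('i \<Rightarrow>\<^sub>0 'k) \<Rightarrow> ('j \<Rightarrow>\<^sub>0 'k)" where
  "lin f p = (\<Sum>i\<in>Poly_Mapping.keys p. scale (Poly_Mapping.lookup p i) (f i))"

definition lin_form :: "('i \<Rightarrow> 'k::comm_ring_1) \<Rightarrow> ('i \<Rightarrow>\<^sub>0 'k) \<Rightarrow> 'k" where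
  "lin_form f p = (\<Sum>i\<in>Poly_Mapping.keys p. Poly_Mapping.lookup p i * f i)"

abbreviation basis :: "'i \<Rightarrow> ('i \<Rightarrow>\<^sub>0 'k::comm_ring_1)" where
  "basis i \<equiv> Poly_Mapping.single i 1"

definition tens :: "('i \<Rightarrow>\<^sub>0 'k::comm_ring_1) \<Rightarrow> ('j \<Rightarrow>\<^sub>0 'k) \<Rightarrow> ('i \<times> 'j \<Rightarrow>\<^sub>0 'k)" where
  "tens p q = lin (\<lambda>i. lin (\<lambda>j. basis (i, j)) q) p"


section \<open>The category of generic structures over the positive integers\<close>

type_synonym word = "nat list"

text \<open>A tensor product of words \<open>w\<^sub>1 \<otimes> \<dots> \<otimes> w\<^sub>m\<close> is the list \<open>[w\<^sub>1, \<dots>, w\<^sub>m]\<close>.\<close>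

type_synonym word_tensor = "word list"

definition generic :: "word_tensor \<Rightarrow> bool" where
  "generic t \<longleftrightarrow> distinct (concat t) \<and> 0 \<notin> set (concat t)"

text \<open>
  All the generating maps \<open>V\<^sub>t \<rightarrow> V\<^sub>t\<^sub>'\<close> send the basis vector of the source to that of the target,
  so the space of morphisms \<open>V\<^sub>t \<rightarrow> V\<^sub>t\<^sub>'\<close> is either \<open>0\<close> or the line spanned by this map; it is that
  line precisely when \<open>gen_arrow t t'\<close> holds for the relation below.
  It is closed under tensor products, as the category is monoidal.
  Starting from a generic \<open>t\<close>, all \<open>t'\<close> that can be reached are generic.
\<close>

inductive gen_arrow :: "word_tensor \<Rightarrow> word_tensor \<Rightarrow> bool" where
  regroup: "concat t = concat t' \<Longrightarrow> gen_arrow t t'"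
| erase: "gen_arrow [u @ n # v] [u @ v]"
| symmetry: "gen_arrow (t @ t') (t' @ t)"
| comp: "gen_arrow t t' \<Longrightarrow> gen_arrow t' t'' \<Longrightarrow> gen_arrow t t''"
| tensor: "gen_arrow t t' \<Longrightarrow> gen_arrow s s' \<Longrightarrow> gen_arrow (t @ s) (t' @ s')"

text \<open>The object \<open>\<Oplus>\<^sub>i V\<^bsub>label i\<^esub>\<close>, with \<open>i\<close> ranging over \<open>index\<close> (multiplicities are allowed).\<close>

record 'i gen_object =
  index :: "'i set"
  label :: "'i \<Rightarrow> word_tensor"

definition is_gen_object :: "('i, 'z) gen_object_scheme \<Rightarrow> bool" where
  "is_gen_object A \<longleftrightarrow> (\<forall>i\<in>index A. generic (label A i))"

definition gen_unit :: "unit gen_object" where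
  "gen_unit = \<lparr>index = UNIV, label = (\<lambda>_. [])\<rparr>"

definition gen_tensor ::
    "('i, 'y) gen_object_scheme \<Rightarrow> ('j, 'z) gen_object_scheme \<Rightarrow> ('i \<times> 'j) gen_object" where
  "gen_tensor A B =
     \<lparr>index = {(i, j). i \<in> index A \<and> j \<in> index B \<and> generic (label A i @ label B j)},
      label = (\<lambda>(i, j). label A i @ label B j)\<rparr>"

definition gen_hom :: "('i, 'y) gen_object_scheme \<Rightarrow> ('j, 'z) gen_object_scheme
    \<Rightarrow> ('i \<Rightarrow> ('j \<Rightarrow>\<^sub>0 'k::comm_ring_1)) \<Rightarrow> bool" where
  "gen_hom A B f \<longleftrightarrow>
     (\<forall>i\<in>index A. Poly_Mapping.keys (f i) \<subseteq> {j \<in> index B. gen_arrow (label A i) (label B j)})"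


section \<open>Generic bialgebras\<close>

record (overloaded) ('i, 'k) gen_bialgebra = "'i gen_object" +
  eta :: "'i \<Rightarrow>\<^sub>0 'k"
  eps :: "'i \<Rightarrow> 'k"
  mult :: "'i \<times> 'i \<Rightarrow> ('i \<Rightarrow>\<^sub>0 'k)"
  comult :: "'i \<Rightarrow> ('i \<times> 'i \<Rightarrow>\<^sub>0 'k)"

definition is_gen_bialgebra :: "('i, 'k::comm_ring_1) gen_bialgebra \<Rightarrow> bool" where
  "is_gen_bialgebra H \<longleftrightarrow>
     is_gen_object H \<and>
     \<comment> \<open>the structure maps are morphisms\<close>
     gen_hom gen_unit H (\<lambda>_. eta H) \<and>
     gen_hom H gen_unit (\<lambda>i. Poly_Mapping.single () (eps H i)) \<and>
     gen_hom (gen_tensor H H) H (mult H) \<and>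
     gen_hom H (gen_tensor H H) (comult H) \<and>
     \<comment> \<open>algebra\<close>
     (\<forall>i\<in>index H. \<forall>j\<in>index H. \<forall>k\<in>index H. generic (label H i @ label H j @ label H k) \<longrightarrow>
        lin (mult H) (tens (mult H (i, j)) (basis k)) =
        lin (mult H) (tens (basis i) (mult H (j, k)))) \<and>
     (\<forall>i\<in>index H. lin (mult H) (tens (eta H) (basis i)) = basis i \<and>
                  lin (mult H) (tens (basis i) (eta H)) = basis i) \<and>
     \<comment> \<open>coalgebra\<close>
     (\<forall>i\<in>index H.
        lin (\<lambda>(a, b). lin (\<lambda>(c, d). basis (c, d, b)) (comult H a)) (comult H i) =
        lin (\<lambda>(a, b). lin (\<lambda>(c, d). basis (a, c, d)) (comult H b)) (comult H i)) \<and>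
     (\<forall>i\<in>index H. lin (\<lambda>(a, b). scale (eps H a) (basis b)) (comult H i) = basis i \<and>
                  lin (\<lambda>(a, b). scale (eps H b) (basis a)) (comult H i) = basis i) \<and>
     \<comment> \<open>compatibility\<close>
     (\<forall>(i, j)\<in>index (gen_tensor H H).
        lin (comult H) (mult H (i, j)) =
        lin (\<lambda>((a, b), (c, d)). tens (mult H (a, c)) (mult H (b, d)))
          (tens (comult H i) (comult H j))) \<and>
     (\<forall>(i, j)\<in>index (gen_tensor H H). lin_form (eps H) (mult H (i, j)) = eps H i * eps H j) \<and>
     lin (comult H) (eta H) = tens (eta H) (eta H) \<and>
     lin_form (eps H) (eta H) = 1"

text \<open>\<open>H = \<Oplus>\<^sub>n H\<^sub>n\<close>, where \<open>H\<^sub>n\<close> is the summand with index set \<open>{i \<in> index H. deg i = n}\<close>.\<close>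

definition is_standard_gen_bialgebra ::
    "('i \<Rightarrow> nat) \<Rightarrow> ('i, 'k::comm_ring_1) gen_bialgebra \<Rightarrow> bool" where
  "is_standard_gen_bialgebra deg H \<longleftrightarrow>
     is_gen_bialgebra H \<and>
     (\<exists>e\<in>index H. {i \<in> index H. deg i = 0} = {e} \<and> concat (label H e) = [] \<and>
        eta H = basis e \<and> (\<forall>i\<in>index H. eps H i = (if i = e then 1 else 0))) \<and>
     (\<forall>i\<in>index H. \<forall>(a, b)\<in>Poly_Mapping.keys (comult H i). deg a + deg b = deg i) \<and>
     (\<forall>(i, j)\<in>index (gen_tensor H H). 0 < deg i \<longrightarrow> 0 < deg j \<longrightarrow>
        (\<forall>k\<in>Poly_Mapping.keys (mult H (i, j)). 0 < deg k \<and> deg k \<le> deg i + deg j))"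

definition is_gen_bialgebra_iso ::
    "('i, 'k::comm_ring_1) gen_bialgebra \<Rightarrow> ('j, 'k) gen_bialgebra
      \<Rightarrow> ('i \<Rightarrow> ('j \<Rightarrow>\<^sub>0 'k)) \<Rightarrow> bool" where
  "is_gen_bialgebra_iso H H' f \<longleftrightarrow>
     gen_hom H H' f \<and>
     (\<exists>g. gen_hom H' H g \<and> (\<forall>i\<in>index H. lin g (f i) = basis i) \<and>
          (\<forall>j\<in>index H'. lin f (g j) = basis j)) \<and>
     lin f (eta H) = eta H' \<and>
     (\<forall>i\<in>index H. lin_form (eps H') (f i) = eps H i) \<and>
     (\<forall>(i, j)\<in>index (gen_tensor H H). lin f (mult H (i, j)) = lin (mult H') (tens (f i) (f j))) \<and>
     (\<forall>i\<in>index H. lin (comult H') (f i) = lin (\<lambda>(a, b). tens (f a) (f b)) (comult H i))"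


section \<open>Generic shuffle and quasi-shuffle bialgebras\<close>

definition deconcatenation :: "word \<Rightarrow> (word \<times> word \<Rightarrow>\<^sub>0 'k::comm_ring_1)" where
  "deconcatenation w = (\<Sum>i\<le>length w. basis (take i w, drop i w))"

text \<open>
  \<open>shuffles u v\<close> is a set; for words in generic position (no common and no repeated letter)
  distinct shuffles are distinct words, so no multiplicities are lost.
\<close>

definition shuffle_prod :: "word \<times> word \<Rightarrow> (word \<Rightarrow>\<^sub>0 'k::comm_ring_1)" where
  "shuffle_prod = (\<lambda>(u, v). \<Sum>w\<in>shuffles u v. basis w)"

definition cons_lin :: "nat \<Rightarrow> (word \<Rightarrow>\<^sub>0 'k::comm_ring_1) \<Rightarrow> (word \<Rightarrow>\<^sub>0 'k)" where
  "cons_lin n = lin (\<lambda>w. basis (n # w))"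

text \<open>Only meaningful on words in generic position: the denominators are then non-zero.\<close>

fun qshuffle :: "word \<Rightarrow> word \<Rightarrow> (word \<Rightarrow>\<^sub>0 'k::field_char_0)" where
  "qshuffle [] v = basis v"
| "qshuffle (n # u) [] = basis (n # u)"
| "qshuffle (n # u) (m # v) =
     cons_lin n (qshuffle u (m # v)) + cons_lin m (qshuffle (n # u) v) +
     scale (1 / (of_nat n - of_nat m))
       (cons_lin n (qshuffle u v) - cons_lin m (qshuffle u v))"

text \<open>The object \<open>T\<^sup>g(\<nat>\<^sup>*)\<close>, with one summand for each generic word.\<close>

definition Tg :: "word gen_object" where
  "Tg = \<lparr>index = {w. generic [w]}, label = (\<lambda>w. [w])\<rparr>"

definition Shg :: "(word, 'k::comm_ring_1) gen_bialgebra" where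
  "Shg = \<lparr>index = index Tg, label = label Tg,
     eta = basis [], eps = (\<lambda>w. if w = [] then 1 else 0),
     mult = shuffle_prod, comult = deconcatenation\<rparr>"

definition QShg :: "(word, 'k::field_char_0) gen_bialgebra" where
  "QShg = \<lparr>index = index Tg, label = label Tg,
     eta = basis [], eps = (\<lambda>w. if w = [] then 1 else 0),
     mult = (\<lambda>(u, v). qshuffle u v), comult = deconcatenation\<rparr>"


section \<open>The map \<open>\<psi>\<close>\<close>

definition compositions :: "nat \<Rightarrow> nat list set" where
  "compositions k = {\<mu>. sum_list \<mu> = k \<and> (\<forall>m\<in>set \<mu>. 0 < m)}"

lemma finite_compositions: "finite (compositions k)"
proof (rule finite_subset)
  have "length \<mu> \<le> sum_list \<mu>" if "\<forall>m\<in>set \<mu>. 0 < m" for \<mu> :: "nat list"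
    using that by (induction \<mu>) force+
  then show "compositions k \<subseteq> {\<mu>. set \<mu> \<subseteq> {..k} \<and> length \<mu> \<le> k}"
    by (auto simp: compositions_def member_le_sum_list)
  show "finite {\<mu>. set \<mu> \<subseteq> {..k} \<and> length \<mu> \<le> k}"
    by (rule finite_lists_length_le) simp
qed

text \<open>The iterated product of the letters of a block of pairwise distinct letters.\<close>

definition block_Q :: "word \<Rightarrow> (word \<Rightarrow>\<^sub>0 'k::field_char_0)" where
  "block_Q v = (\<Sum>j<length v.
     scale (1 / (\<Prod>l\<in>{..<length v} - {j}. (of_nat (v ! j) - of_nat (v ! l)))) (basis [v ! j]))"

definition conc :: "(word \<Rightarrow>\<^sub>0 'k::comm_ring_1) \<Rightarrow> (word \<Rightarrow>\<^sub>0 'k) \<Rightarrow> (word \<Rightarrow>\<^sub>0 'k)" where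
  "conc p q = lin (\<lambda>(u, v). basis (u @ v)) (tens p q)"

text \<open>
  With \<open>M\<^sub>s = \<mu>\<^sub>1 + \<dots> + \<mu>\<^sub>s\<close>, the \<open>s\<close>-th block (counting from \<open>0\<close>) of \<open>w\<close> consists of the
  \<open>\<mu> ! s\<close> letters that follow the first \<open>M\<^sub>s = sum_list (take s \<mu>)\<close> ones.
\<close>

definition psi :: "word \<Rightarrow> (word \<Rightarrow>\<^sub>0 'k::field_char_0)" where
  "psi w =
     (if w = [] then basis []
      else (\<Sum>\<mu>\<in>compositions (length w).
        scale ((- 1) ^ (length w - length \<mu>) / of_nat (prod_list \<mu>))
          (foldr conc
            (map (\<lambda>s. block_Q (take (\<mu> ! s) (drop (sum_list (take s \<mu>)) w))) [0..<length \<mu>])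
            (basis []))))"

end

theory Submission
  imports Defs "HOL-Computational_Algebra.Polynomial"
begin

text \<open>
  Both products are tamed by the same device: enough characters. Attach to a list \<open>x\<^sub>1, \<dots>, x\<^sub>r\<close> of
  points the nested sum \<open>S [n\<^sub>1 \<dots> n\<^sub>k]\<close>, the sum of the products
  \<open>E x\<^sub>i\<^sub>(\<^sub>1\<^sub>) n\<^sub>1 \<cdots> E x\<^sub>i\<^sub>(\<^sub>k\<^sub>) n\<^sub>k\<close> over all indices \<open>i(1) < \<dots> < i(k)\<close>, for letter functions
  \<open>E\<close>. If distinct letters satisfy \<open>E x n \<cdot> E x m = c / (n - m) \<cdot> (E x n - E x m)\<close>, then \<open>S\<close> turns
  the product in which two letters merge to \<open>c / (n - m) \<cdot> ([n] - [m])\<close> into a product of scalars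
  (\<open>nested_mult\<close>). For \<open>c = 1\<close>
  such a function is \<open>E x n = 1 / (z - n)\<close> with \<open>z = - (x + 1)\<close>, by the elementary partial fraction
  identity; for \<open>c = 0\<close>, the shuffle product, it is the indicator of \<open>n = x\<close>. In both cases the
  functionals \<open>S\<close> separate the linear combinations of words (\<open>nested_separating\<close>), and
  concatenating lists of points corresponds to convolving along deconcatenation. So associativity
  and the compatibility of product and coproduct hold because they hold after applying all the \<open>S\<close>.

  For the isomorphism, sorting the compositions in \<open>psi w\<close> by their first part gives
  \<open>psi w = \<Sum>\<^sub>i log_block (take i w) \<cdot> psi (drop i w)\<close> over \<open>i \<ge> 1\<close>, where \<open>log_block v\<close> is
  \<open>(-1) ^ (k - 1) / k\<close> times the iterated product of the \<open>k\<close> letters of \<open>v\<close>. Consequently composing the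
  nested sum of the shuffle algebra at \<open>x\<^sub>1, \<dots>, x\<^sub>r\<close> with \<open>psi\<close> gives the convolution of functionals
  \<open>log_char x\<^sub>1, \<dots>, log_char x\<^sub>r\<close> that extract the coefficient of the letter \<open>x\<^sub>i\<close> from a
  log block (\<open>nested_psi\<close>). This makes \<open>psi\<close> a coalgebra map, and an algebra map as soon as each
  \<open>log_char x\<close> is a character of the quasi-shuffle algebra. As \<open>x\<close> cannot occur in two words in
  generic position, that says that \<open>log_block\<close> kills \<open>u \<star> v\<close> for nonempty \<open>u\<close> and \<open>v\<close>
  (\<open>log_block_qshuffle\<close>). By partial fractions, evaluating letters by \<open>pole x\<close> gives the same value to all
  quasi-shuffles of \<open>u\<close> and \<open>v\<close>, up to a weight depending on their lengths only; what remains is the identity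
  \<open>\<Sum>\<^sub>r (-1) ^ (r - 1) / r \<cdot> N\<^sub>r = 0\<close> for the numbers \<open>N\<^sub>r\<close> of quasi-shuffles of length \<open>r\<close>. It is the
  coefficient of \<open>z\<close> in \<open>\<Sum>\<^sub>r N\<^sub>r (z choose r) = (z choose k) (z choose l)\<close>, which has a double
  zero at \<open>z = 0\<close>.

  Finally, \<open>psi w\<close> is \<open>w\<close> plus words that are shorter and use only letters of \<open>w\<close>. Such a
  unitriangular map has an inverse of the same kind, and both are morphisms because there is an
  arrow from one generic word to another whenever the letters of the latter occur in the former.
\<close>


section \<open>Linear extension\<close>

abbreviation keys :: "('i \<Rightarrow>\<^sub>0 'k::zero) \<Rightarrow> 'i set" where
  "keys \<equiv> Poly_Mapping.keys"

abbreviation lookup :: "('i \<Rightarrow>\<^sub>0 'k::zero) \<Rightarrow> 'i \<Rightarrow> 'k" where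
  "lookup \<equiv> Poly_Mapping.lookup"

lemma lookup_scale [simp]: "lookup (scale c p) i = c * lookup p i"
  by (simp add: scale_def Poly_Mapping.map.rep_eq when_def)

lemma lin_form_superset:
  assumes "finite A" "keys p \<subseteq> A"
  shows "lin_form f p = (\<Sum>i\<in>A. lookup p i * f i)"
  unfolding lin_form_def using assms
  by (intro sum.mono_neutral_left) (auto simp: in_keys_iff)

lemma lin_form_zero [simp]: "lin_form f 0 = 0"
  by (simp add: lin_form_def)

lemma lin_form_basis [simp]: "lin_form f (basis i) = f i"
  by (subst lin_form_superset[of "{i}"]) auto

lemma lin_form_add: "lin_form f (p + q) = lin_form f p + lin_form f q"
proof -
  have "keys (p + q) \<subseteq> keys p \<union> keys q"
    by (rule Poly_Mapping.keys_add)
  then show ?thesis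
    by (subst (1 2 3) lin_form_superset[of "keys p \<union> keys q"])
      (auto simp: lookup_add algebra_simps sum.distrib)
qed

lemma lin_form_scale: "lin_form f (scale c p) = c * lin_form f p"
proof -
  have "keys (scale c p) \<subseteq> keys p"
    by (auto simp: in_keys_iff)
  then show ?thesis
    by (subst (1 2) lin_form_superset[of "keys p"])
      (auto simp: sum_distrib_left algebra_simps)
qed

lemma lin_form_uminus: "lin_form f (- p) = - lin_form f p"
proof -
  have "- p = scale (- 1) p"
    by (rule poly_mapping_eqI) simp
  then show ?thesis by (simp add: lin_form_scale)
qed

lemma lin_form_diff: "lin_form f (p - q) = lin_form f p - lin_form f q"
  using lin_form_add[of f p "- q"] by (simp add: lin_form_uminus)

lemma lin_form_sum: "lin_form f (\<Sum>a\<in>A. p a) = (\<Sum>a\<in>A. lin_form f (p a))"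
  by (induction A rule: infinite_finite_induct) (auto simp: lin_form_add)

lemma lin_form_fun_add: "lin_form (\<lambda>i. f i + g i) p = lin_form f p + lin_form g p"
  by (simp add: lin_form_def sum.distrib algebra_simps)

lemma lin_form_fun_zero [simp]: "lin_form (\<lambda>i. 0) p = 0"
  by (simp add: lin_form_def)

lemma lin_form_fun_mult: "lin_form (\<lambda>i. c * f i) p = c * lin_form f p"
  by (simp add: lin_form_def sum_distrib_left algebra_simps)

lemma lin_form_fun_mult_right: "lin_form (\<lambda>i. f i * c) p = lin_form f p * c"
  using lin_form_fun_mult[of c f p] by (simp add: mult.commute)

lemma lin_form_cong:
  "(\<And>i. i \<in> keys p \<Longrightarrow> f i = g i) \<Longrightarrow> lin_form f p = lin_form g p"
  by (simp add: lin_form_def)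

lemma lookup_eq_lin_form: "lookup p i = lin_form (\<lambda>k. if k = i then 1 else 0) p"
  by (cases "i \<in> keys p") (auto simp: lin_form_def in_keys_iff if_distrib sum.delta cong: if_cong)

lemma lookup_lin: "lookup (lin f p) j = lin_form (\<lambda>i. lookup (f i) j) p"
  by (simp add: lin_def lin_form_def lookup_sum)

lemma lin_zero [simp]: "lin f 0 = 0"
  by (simp add: lin_def)

lemma lin_basis [simp]: "lin f (basis i) = f i"
  by (rule poly_mapping_eqI) (simp add: lookup_lin)

lemma lin_add: "lin f (p + q) = lin f p + lin f q"
  by (rule poly_mapping_eqI) (simp add: lookup_lin lookup_add lin_form_add)

lemma lin_diff: "lin f (p - q) = lin f p - lin f q"
  by (rule poly_mapping_eqI) (simp add: lookup_lin lookup_minus lin_form_diff)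

lemma lin_sum: "lin f (\<Sum>a\<in>A. p a) = (\<Sum>a\<in>A. lin f (p a))"
  by (induction A rule: infinite_finite_induct) (auto simp: lin_add)

lemma lin_cong:
  "(\<And>i. i \<in> keys p \<Longrightarrow> f i = g i) \<Longrightarrow> lin f p = lin g p"
  by (simp add: lin_def)

lemma lin_fun_diff: "lin (\<lambda>i. f i - g i) p = lin f p - lin g p"
  by (rule poly_mapping_eqI)
    (simp add: lookup_lin lookup_minus lin_form_def sum_subtractf algebra_simps)

lemma lin_id [simp]: "lin basis p = p"
  by (rule poly_mapping_eqI) (simp add: lookup_lin lookup_single when_def flip: lookup_eq_lin_form)

lemma lin_form_lin: "lin_form g (lin f p) = lin_form (\<lambda>i. lin_form g (f i)) p"
proof -
  have "lin_form g (lin f p) = (\<Sum>i\<in>keys p. lookup p i * lin_form g (f i))"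
    by (simp add: lin_def lin_form_sum lin_form_scale)
  then show ?thesis by (simp add: lin_form_def)
qed

lemma lin_lin: "lin g (lin f p) = lin (\<lambda>i. lin g (f i)) p"
  by (rule poly_mapping_eqI) (simp add: lookup_lin lin_form_lin)

lemma lin_form_tens:
  "lin_form g (tens p q) = lin_form (\<lambda>i. lin_form (\<lambda>j. g (i, j)) q) p"
  by (simp add: tens_def lin_form_lin)

lemma lin_form_tens_mult:
  "lin_form (\<lambda>(i, j). f i * g j) (tens p q) = lin_form f p * lin_form g q"
  using lin_form_fun_mult[of "lin_form g q" f p]
  by (simp add: lin_form_tens lin_form_fun_mult mult.commute)

lemma tens_basis [simp]: "tens (basis i) (basis j) = basis (i, j)"
  by (simp add: tens_def)

lemma keys_scale: "keys (scale c p) \<subseteq> keys p"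
  by (auto simp: in_keys_iff)

lemma keys_lin: "keys (lin f p) \<subseteq> (\<Union>i\<in>keys p. keys (f i))"
proof
  fix j assume "j \<in> keys (lin f p)"
  then have "lin_form (\<lambda>i. lookup (f i) j) p \<noteq> 0"
    by (simp add: in_keys_iff lookup_lin)
  then obtain i where "i \<in> keys p" "lookup (f i) j \<noteq> 0"
    unfolding lin_form_def by (force elim: sum.not_neutral_contains_not_neutral)
  then show "j \<in> (\<Union>i\<in>keys p. keys (f i))"
    by (auto simp: in_keys_iff)
qed

lemma keys_tens: "keys (tens p q) \<subseteq> keys p \<times> keys q"
  using keys_lin[of "\<lambda>i. lin (\<lambda>j. basis (i, j)) q" p] keys_lin[of "\<lambda>j. basis (_, j)" q]
  unfolding tens_def by fastforce


lemma keys_sum: "keys (\<Sum>a\<in>A. p a) \<subseteq> (\<Union>a\<in>A. keys (p a))"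
proof
  fix i assume "i \<in> keys (\<Sum>a\<in>A. p a)"
  then have "(\<Sum>a\<in>A. lookup (p a) i) \<noteq> 0"
    by (simp add: in_keys_iff lookup_sum)
  then obtain a where "a \<in> A" "lookup (p a) i \<noteq> 0"
    by (rule sum.not_neutral_contains_not_neutral)
  then show "i \<in> (\<Union>a\<in>A. keys (p a))"
    by (auto simp: in_keys_iff)
qed

lemma lin_form_eqI:
  fixes p q :: "'i \<Rightarrow>\<^sub>0 'k::comm_ring_1"
  assumes "\<And>f. lin_form f p = lin_form f q"
  shows "p = q"
  by (rule poly_mapping_eqI) (simp add: lookup_eq_lin_form assms)

lemma scale_scale: "scale a (scale b p) = scale (a * b) p"
  by (rule poly_mapping_eqI) (simp add: mult.assoc)


section \<open>Arrows between generic words\<close>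

text \<open>
  Regrouping and symmetry bring the first letter of the target to the front, where it can be split
  off as a tensor factor of its own; letters that are never asked for get erased in the end.
\<close>

lemma gen_arrow_words:
  assumes "distinct w'" "set w' \<subseteq> set w"
  shows "gen_arrow [w] [w']"
  using assms
proof (induction w' arbitrary: w)
  case Nil
  show ?case
  proof (induction w)
    case (Cons a w)
    have "gen_arrow [[] @ a # w] [[] @ w]"
      by (rule gen_arrow.erase)
    with Cons show ?case
      by (auto intro: gen_arrow.comp)
  qed (simp add: gen_arrow.regroup)
next
  case (Cons a w')
  then obtain x y where w: "w = x @ a # y"
    by (meson list.set_intros(1) split_list subsetD)
  have "gen_arrow ([x] @ [[a]]) ([[a]] @ [x])"
    by (rule gen_arrow.symmetry)
  from gen_arrow.tensor[OF this gen_arrow.regroup[of "[y]" "[y]"]]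
  have "gen_arrow [x, [a], y] [[a], x, y]" by simp
  moreover have "gen_arrow [w] [x, [a], y]" "gen_arrow [[a], x, y] [[a], x @ y]"
    by (simp_all add: w gen_arrow.regroup)
  ultimately have "gen_arrow [w] [[a], x @ y]"
    by (blast intro: gen_arrow.comp)
  moreover have "gen_arrow [x @ y] [w']"
    using Cons by (intro Cons.IH) (auto simp: w)
  from gen_arrow.tensor[OF gen_arrow.regroup[of "[[a]]" "[[a]]"] this]
  have "gen_arrow [[a], x @ y] [[a], w']" by simp
  moreover have "gen_arrow [[a], w'] [a # w']"
    by (rule gen_arrow.regroup) simp
  ultimately show ?case
    by (blast intro: gen_arrow.comp)
qed

lemma gen_arrowI:
  assumes "distinct (concat t')" "set (concat t') \<subseteq> set (concat t)"
  shows "gen_arrow t t'"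
proof -
  have "gen_arrow t [concat t]" "gen_arrow [concat t'] t'"
    by (rule gen_arrow.regroup, simp)+
  then show ?thesis
    using gen_arrow_words[OF assms] by (blast intro: gen_arrow.comp)
qed


section \<open>Convolution of functionals on words\<close>

definition conv :: "(word \<Rightarrow> 'k::comm_ring_1) \<Rightarrow> (word \<Rightarrow> 'k) \<Rightarrow> word \<Rightarrow> 'k" where
  "conv f g w = (\<Sum>i\<le>length w. f (take i w) * g (drop i w))"

abbreviation counit :: "word \<Rightarrow> 'k::comm_ring_1" where
  "counit w \<equiv> (if w = [] then 1 else 0)"

lemma sum_cuts_Cons:
  "(\<Sum>i\<le>length (a # w). F (take i (a # w)) (drop i (a # w))) =
   F [] (a # w) + (\<Sum>i\<le>length w. F (a # take i w) (drop i w))"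
  for F :: "word \<Rightarrow> word \<Rightarrow> 'b::comm_monoid_add"
  by (simp add: sum.atMost_Suc_shift del: sum.atMost_Suc)

text \<open>
  Coassociativity of deconcatenation, in a form that serves both the coalgebra axiom (where \<open>F\<close>
  takes values in a triple tensor product) and the associativity of convolution (where it takes
  scalar values).
\<close>

lemma sum_cuts_coassoc:
  fixes F :: "word \<Rightarrow> word \<Rightarrow> word \<Rightarrow> 'b::comm_monoid_add"
  shows "(\<Sum>i\<le>length w. \<Sum>j\<le>length (take i w).
            F (take j (take i w)) (drop j (take i w)) (drop i w)) =
         (\<Sum>i\<le>length w. \<Sum>j\<le>length (drop i w).
            F (take i w) (take j (drop i w)) (drop j (drop i w)))"
proof (induction w arbitrary: F)
  case (Cons a w)
  show ?case
    unfolding sum_cuts_Cons[of "\<lambda>u v. \<Sum>j\<le>length u. F (take j u) (drop j u) v"]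
      sum_cuts_Cons[of "\<lambda>u v. \<Sum>j\<le>length v. F u (take j v) (drop j v)"]
    by (subst sum_cuts_Cons[where F = "\<lambda>u v. F [] u v"])
      (simp only: sum_cuts_Cons[where F = "\<lambda>u v. F u v _"] sum.distrib Cons.IH[of "\<lambda>u. F (a # u)"],
       simp add: add.assoc)
qed simp

lemma conv_Nil [simp]: "conv f g [] = f [] * g []"
  by (simp add: conv_def)

lemma conv_Cons: "conv f g (a # w) = f [] * g (a # w) + conv (\<lambda>u. f (a # u)) g w"
  unfolding conv_def sum_cuts_Cons[of "\<lambda>u v. f u * g v"] ..

lemma conv_assoc: "conv (conv f g) h = conv f (conv g h)"
proof
  fix w
  show "conv (conv f g) h w = conv f (conv g h) w"
    using sum_cuts_coassoc[of "\<lambda>a b c. f a * g b * h c" w]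
    by (simp add: conv_def sum_distrib_left sum_distrib_right mult.assoc)
qed

lemma conv_zero_left [simp]: "conv (\<lambda>u. 0) g w = 0"
  by (simp add: conv_def)

lemma conv_counit_left [simp]: "conv counit g = g"
proof
  fix w show "conv counit g w = g w"
    by (cases w) (simp_all add: conv_Cons)
qed

lemma conv_counit_right [simp]: "conv f counit = f"
proof
  fix w show "conv f counit w = f w"
    by (induction w arbitrary: f) (simp_all add: conv_Cons)
qed

lemma conv_scale_left: "conv (\<lambda>u. c * f u) g w = c * conv f g w"
  by (simp add: conv_def sum_distrib_left mult.assoc)

definition conv_list :: "('a \<Rightarrow> word \<Rightarrow> 'k::comm_ring_1) \<Rightarrow> 'a list \<Rightarrow> word \<Rightarrow> 'k" where
  "conv_list f xs = foldr (\<lambda>x. conv (f x)) xs counit"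

lemma conv_list_Nil: "conv_list f [] = counit"
  by (simp add: conv_list_def)

lemma conv_list_Cons: "conv_list f (x # xs) = conv (f x) (conv_list f xs)"
  by (simp add: conv_list_def)

lemma conv_list_append: "conv_list f (xs @ ys) = conv (conv_list f xs) (conv_list f ys)"
  by (induction xs) (simp_all only: conv_list_Nil conv_list_Cons conv_counit_left conv_assoc append.simps)

lemma lin_form_deconcatenation:
  "lin_form F (deconcatenation w) = (\<Sum>i\<le>length w. F (take i w, drop i w))"
  by (simp add: deconcatenation_def lin_form_sum)

lemma lin_deconcatenation:
  "lin F (deconcatenation w) = (\<Sum>i\<le>length w. F (take i w, drop i w))"
  by (simp add: deconcatenation_def lin_sum)

lemma conv_eq_lin_form: "conv f g w = lin_form (\<lambda>(u, v). f u * g v) (deconcatenation w)"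
  by (simp add: lin_form_deconcatenation conv_def)

lemma keys_deconcatenation:
  "keys (deconcatenation w :: _ \<Rightarrow>\<^sub>0 'k::comm_ring_1) \<subseteq> (\<lambda>i. (take i w, drop i w)) ` {..length w}"
proof -
  have "keys (\<Sum>i\<in>A. basis (take i w, drop i w) :: _ \<Rightarrow>\<^sub>0 'k)
      \<subseteq> (\<lambda>i. (take i w, drop i w)) ` A" if "finite A" for A
    using that
  proof induction
    case (insert i A)
    then show ?case
      using Poly_Mapping.keys_add[of "basis (take i w, drop i w) :: _ \<Rightarrow>\<^sub>0 'k"
        "\<Sum>i\<in>A. basis (take i w, drop i w)"] by auto
  qed simp
  then show ?thesis
    by (simp add: deconcatenation_def)
qed


section \<open>Nested sums as characters\<close>

definition letter_functional :: "(nat \<Rightarrow> 'k::comm_ring_1) \<Rightarrow> word \<Rightarrow> 'k" where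
  "letter_functional e w = (case w of [] \<Rightarrow> 1 | [n] \<Rightarrow> e n | _ \<Rightarrow> 0)"

text \<open>
  The nested sum of a word over the points of a list: points are used in order, each for at most one
  letter.
\<close>

definition nested :: "(nat \<Rightarrow> nat \<Rightarrow> 'k::comm_ring_1) \<Rightarrow> nat list \<Rightarrow> word \<Rightarrow> 'k" where
  "nested E = conv_list (\<lambda>x. letter_functional (E x))"

lemma nested_Nil: "nested E [] w = counit w"
  by (simp add: nested_def conv_list_Nil)

lemma nested_append: "nested E (xs @ ys) = conv (nested E xs) (nested E ys)"
  by (simp add: nested_def conv_list_append)

lemma nested_word_Nil [simp]: "nested E xs [] = 1"
  by (induction xs) (simp_all add: nested_def conv_list_Nil conv_list_Cons letter_functional_def)

lemma nested_Cons_Cons [simp]: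
  "nested E (x # xs) (n # w) = nested E xs (n # w) + E x n * nested E xs w"
proof -
  have "(\<lambda>u. letter_functional (E x) (n # u)) = (\<lambda>u. E x n * counit u)"
    by (auto simp: letter_functional_def split: list.split)
  then show ?thesis
    by (simp add: nested_def conv_list_Cons conv_Cons conv_scale_left)
      (simp add: letter_functional_def)
qed

lemma lin_form_cons_lin: "lin_form f (cons_lin n p) = lin_form (\<lambda>w. f (n # w)) p"
  by (simp add: cons_lin_def lin_form_lin)

lemma keys_cons_lin:
  "w \<in> keys (cons_lin n p :: word \<Rightarrow>\<^sub>0 'k::comm_ring_1) \<Longrightarrow> \<exists>w'. w = n # w' \<and> w' \<in> keys p"
  using keys_lin[of "\<lambda>w. basis (n # w) :: word \<Rightarrow>\<^sub>0 'k" p] by (auto simp: cons_lin_def)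

lemma lin_form_nested_cons_lin:
  "lin_form (nested E (x # xs)) (cons_lin n p) =
   lin_form (nested E xs) (cons_lin n p) + E x n * lin_form (nested E xs) p"
  by (simp add: lin_form_cons_lin lin_form_fun_add lin_form_fun_mult)

text \<open>
  Comparing the nested sums over \<open>x # xs\<close> and \<open>xs\<close> isolates the words according to their first
  letter: their difference is \<open>\<Sum>\<^sub>n E x n \<cdot> S xs (p\<^sub>n)\<close>, where \<open>p\<^sub>n\<close> collects the tails of the words that
  start with \<open>n\<close>. As functions of \<open>x\<close> the letters are linearly independent, so all nested sums vanish
  on each \<open>p\<^sub>n\<close>, whose words are shorter.
\<close>

lemma nested_separating:
  fixes p :: "word \<Rightarrow>\<^sub>0 'k::comm_ring_1"
  assumes letters: "\<And>q. (\<And>x. lin_form (E x) q = 0) \<Longrightarrow> q = 0"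
  assumes "\<And>w. w \<in> keys p \<Longrightarrow> length w \<le> k"
  assumes "\<And>xs. lin_form (nested E xs) p = 0"
  shows "p = 0"
  using assms(2,3)
proof (induction k arbitrary: p)
  case 0
  have "lin_form counit p = 0"
    using "0.prems"(2)[of "[]"] by (simp add: nested_def conv_list_Nil)
  then have "lookup p [] = 0"
    by (simp add: lookup_eq_lin_form)
  with "0.prems"(1) show ?case
    by (metis in_keys_iff keys_eq_empty le_zero_eq length_0_conv subsetI subset_empty)
next
  case (Suc k)
  \<comment> \<open>the words of \<open>p\<close> that start with \<open>n\<close>, with this letter removed\<close>
  define tails where
    "tails n = lin (\<lambda>w. case w of [] \<Rightarrow> 0 | m # v \<Rightarrow> if m = n then basis v else 0) p" for n
  have lookup_tails: "lookup (tails n) v = lookup p (n # v)" for n v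
    unfolding tails_def lookup_lin lookup_eq_lin_form[of p]
    by (rule lin_form_cong) (auto simp: lookup_single when_def split: list.split)
  have tails_char: "lin_form (nested E xs) (tails n) = 0" for xs n
  proof -
    \<comment> \<open>first letters weighted by the nested sum of the tail; its \<open>E x\<close>-value is the difference
      of the nested sums over \<open>x # xs\<close> and \<open>xs\<close>\<close>
    define q where
      "q = lin (\<lambda>w. case w of [] \<Rightarrow> 0 | m # v \<Rightarrow> scale (nested E xs v) (basis m)) p"
    have "lin_form (E x) q = 0" for x
    proof -
      have "lin_form (nested E (x # xs)) p =
            lin_form (\<lambda>w. nested E xs w + (case w of [] \<Rightarrow> 0 | m # v \<Rightarrow> E x m * nested E xs v)) p"
        by (rule lin_form_cong) (auto split: list.split)
      then have "lin_form (\<lambda>w. case w of [] \<Rightarrow> 0 | m # v \<Rightarrow> E x m * nested E xs v) p = 0"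
        by (simp add: lin_form_fun_add Suc.prems)
      moreover have "lin_form (E x) q =
          lin_form (\<lambda>w. case w of [] \<Rightarrow> 0 | m # v \<Rightarrow> E x m * nested E xs v) p"
        unfolding q_def lin_form_lin
        by (rule lin_form_cong) (auto simp: lin_form_scale mult.commute split: list.split)
      ultimately show ?thesis by simp
    qed
    then have "q = 0" by (rule letters)
    then have "0 = lookup q n" by simp
    also have "\<dots> = lin_form (nested E xs) (tails n)"
      unfolding q_def tails_def lookup_lin lin_form_lin
      by (rule lin_form_cong) (auto simp: lookup_single when_def split: list.split)
    finally show ?thesis by simp
  qed
  have "tails n = 0" for n
  proof (rule Suc.IH)
    show "length v \<le> k" if "v \<in> keys (tails n)" for v
      using Suc.prems(1)[of "n # v"] that by (simp add: in_keys_iff lookup_tails)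
  qed (rule tails_char)
  then have "lookup p (n # v) = 0" for n v
    by (metis lookup_tails lookup_zero)
  moreover have "lookup p [] = 0"
    using Suc.prems(2)[of "[]"] by (simp add: nested_def conv_list_Nil lookup_eq_lin_form)
  ultimately have "lookup p w = 0" for w
    by (cases w) auto
  then show ?case
    by (intro poly_mapping_eqI) simp
qed

text \<open>
  The shuffle product (\<open>c = 0\<close>) and the quasi-shuffle product (\<open>c = 1\<close>) at once. The functions
  \<open>E x\<close> are characters of the letters under the merging \<open>[n] \<cdot> [m] = c / (n - m) \<cdot> ([n] - [m])\<close>.
\<close>

locale generic_quasi_shuffle =
  fixes P :: "word \<times> word \<Rightarrow> (word \<Rightarrow>\<^sub>0 'k::field_char_0)"
    and E :: "nat \<Rightarrow> nat \<Rightarrow> 'k"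
    and c :: 'k
  assumes P_Nil_left: "P ([], v) = basis v"
    and P_Nil_right: "P (u, []) = basis u"
    and P_Cons: "generic [n # u, m # v] \<Longrightarrow> P (n # u, m # v) =
      cons_lin n (P (u, m # v)) + cons_lin m (P (n # u, v)) +
      scale (c / (of_nat n - of_nat m)) (cons_lin n (P (u, v)) - cons_lin m (P (u, v)))"
    and E_mult: "n \<noteq> m \<Longrightarrow> E x n * E x m = c / (of_nat n - of_nat m) * (E x n - E x m)"
    and E_separating: "(\<And>x. lin_form (E x) q = 0) \<Longrightarrow> q = 0"
begin

text \<open>
  The first point either is skipped or serves the first letter of one of the words or, through a
  merged letter, of both. These four possibilities are the four terms of the product
  \<open>(S (n # u) + E x n \<cdot> S u) \<cdot> (S (m # v) + E x m \<cdot> S v)\<close>.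
\<close>

lemma nested_mult:
  assumes "generic [u, v]"
  shows "lin_form (nested E xs) (P (u, v)) = nested E xs u * nested E xs v"
proof -
  have "u = [] \<or> v = [] \<or> (\<exists>n u' m v'. u = n # u' \<and> v = m # v')" for u v :: word
    by (metis neq_Nil_conv)
  note cases = this
  from assms show ?thesis
  proof (induction xs arbitrary: u v)
    case Nil
    show ?case
      using cases[of u v] Nil.prems
      by (auto simp: nested_Nil P_Nil_left P_Nil_right P_Cons lin_form_add lin_form_diff
          lin_form_scale lin_form_cons_lin)
  next
    case (Cons x xs)
    have "lin_form (nested E (x # xs)) (P (n # u', m # v')) =
          nested E (x # xs) (n # u') * nested E (x # xs) (m # v')"
      if g: "generic [n # u', m # v']" for n u' m v'
    proof -
      have sub: "generic [u', m # v']" "generic [n # u', v']" "generic [u', v']" "n \<noteq> m"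
        using g by (auto simp: generic_def)
      define d where "d = c / (of_nat n - of_nat m)"
      have d: "d * (E x n - E x m) = E x n * E x m"
        using E_mult[OF sub(4)] by (simp add: d_def)
      have "lin_form (nested E (x # xs)) (P (n # u', m # v')) =
          lin_form (nested E xs) (P (n # u', m # v')) +
          E x n * lin_form (nested E xs) (P (u', m # v')) +
          E x m * lin_form (nested E xs) (P (n # u', v')) +
          d * (E x n - E x m) * lin_form (nested E xs) (P (u', v'))"
        unfolding P_Cons[OF g] d_def[symmetric]
        by (simp add: lin_form_add lin_form_diff lin_form_scale
            lin_form_nested_cons_lin algebra_simps)
      also have "\<dots> = (nested E xs (n # u') + E x n * nested E xs u') *
                       (nested E xs (m # v') + E x m * nested E xs v')"
        unfolding d by (simp add: Cons.IH g sub) (simp add: algebra_simps)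
      finally show ?thesis by simp
    qed
    then show ?case
      using cases[of u v] Cons.prems by (auto simp: P_Nil_left P_Nil_right)
  qed
qed

lemma eqI:
  assumes "\<And>xs. lin_form (nested E xs) p = lin_form (nested E xs) q"
  shows "p = q"
proof -
  have "p - q = 0"
  proof (rule nested_separating[where E = E])
    show "length w \<le> Max (length ` keys (p - q))" if "w \<in> keys (p - q)" for w
      using that by simp
  qed (use assms E_separating in \<open>auto simp: lin_form_diff\<close>)
  then show ?thesis by simp
qed

text \<open>
  The functionals \<open>S xs \<otimes> S ys\<close> separate tensors: fixing \<open>xs\<close> and letting \<open>ys\<close> vary reduces this to
  single words in the second factor, and then again in the first.
\<close>

lemma eq_pairI:
  fixes p q :: "word \<times> word \<Rightarrow>\<^sub>0 'k"
  assumes "\<And>xs ys. lin_form (\<lambda>(u, v). nested E xs u * nested E ys v) p =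
                   lin_form (\<lambda>(u, v). nested E xs u * nested E ys v) q"
  shows "p = q"
proof (rule poly_mapping_eqI)
  fix uv :: "word \<times> word"
  obtain u v where uv: "uv = (u, v)" by fastforce
  define left where
    "left r = lin (\<lambda>(a, b). if b = v then basis a else 0) r" for r :: "word \<times> word \<Rightarrow>\<^sub>0 'k"
  define right where
    "right xs r = lin (\<lambda>(a, b). scale (nested E xs a) (basis b)) r"
    for xs and r :: "word \<times> word \<Rightarrow>\<^sub>0 'k"
  have "right xs p = right xs q" for xs
    using assms[of xs]
    by (intro eqI) (simp add: right_def lin_form_lin lin_form_scale case_prod_unfold)
  moreover have "lookup (right xs r) v = lin_form (nested E xs) (left r)" for xs r
    unfolding right_def left_def lookup_lin lin_form_lin
    by (rule lin_form_cong) (auto simp: lookup_single when_def)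
  ultimately have "left p = left q"
    by (metis eqI)
  moreover have "lookup (left r) u = lookup r (u, v)" for r
    unfolding left_def lookup_lin lookup_eq_lin_form[of r]
    by (rule lin_form_cong) (auto simp: lookup_single when_def split: if_splits)
  ultimately show "lookup p uv = lookup q uv"
    by (metis uv)
qed


lemma keys_P:
  assumes "generic [u, v]" "w \<in> keys (P (u, v))"
  shows "distinct w \<and> set w \<subseteq> set u \<union> set v"
  using assms
proof (induction "length u + length v" arbitrary: u v w rule: less_induct)
  case less
  consider "u = []" | "v = []" | n u' m v' where "u = n # u'" "v = m # v'"
    by (metis neq_Nil_conv)
  then show ?case
  proof cases
    case 3
    have gen: "generic [n # u', m # v']"
      using less.prems 3 by simp
    have hyp: "distinct w' \<and> set w' \<subseteq> set a \<union> set b"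
      if "length a + length b < length u + length v" "generic [a, b]" "w' \<in> keys (P (a, b))"
      for a b w'
      using less.hyps that by blast
    have "w \<in> keys (cons_lin n (P (u', m # v'))) \<union> keys (cons_lin m (P (n # u', v'))) \<union>
        keys (cons_lin n (P (u', v'))) \<union> keys (cons_lin m (P (u', v')))"
      using less.prems(2) unfolding 3 P_Cons[OF gen]
      by (auto simp: in_keys_iff lookup_add lookup_minus)
    then consider w' where "w = n # w'" "w' \<in> keys (P (u', m # v'))"
      | w' where "w = m # w'" "w' \<in> keys (P (n # u', v'))"
      | a w' where "w = a # w'" "a = n \<or> a = m" "w' \<in> keys (P (u', v'))"
      by (auto dest!: keys_cons_lin)
    then show ?thesis
    proof cases
      case (1 w')
      then show ?thesis
        using hyp[of u' "m # v'" w'] gen by (auto simp: generic_def 3)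
    next
      case (2 w')
      then show ?thesis
        using hyp[of "n # u'" v' w'] gen by (auto simp: generic_def 3)
    next
      case (3 a w')
      then show ?thesis
        using hyp[of u' v' w'] gen by (auto simp: generic_def \<open>u = n # u'\<close> \<open>v = m # v'\<close>)
    qed
  qed (use less.prems in \<open>auto simp: P_Nil_left P_Nil_right generic_def\<close>)
qed

definition multiplicative :: "(word \<Rightarrow> 'k) \<Rightarrow> bool" where
  "multiplicative f \<longleftrightarrow> (\<forall>u v. generic [u, v] \<longrightarrow> lin_form f (P (u, v)) = f u * f v)"

lemma generic_take_drop:
  assumes "generic [u, v]"
  shows "generic [take i u, take j v]" "generic [drop i u, drop j v]"
  using assms set_take_subset[of i u] set_take_subset[of j v]
    set_drop_subset[of i u] set_drop_subset[of j v]
  by (auto simp: generic_def)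

text \<open>
  This is the step from a product of convolutions to a convolution on products; it only needs that
  cutting two words in generic position leaves the pieces in generic position.
\<close>

lemma tensor_square_conv:
  assumes "multiplicative f" "multiplicative g" "generic [u, v]"
  shows "lin_form (\<lambda>(a, b). f a * g b)
      (lin (\<lambda>((a, b), (c, d)). tens (P (a, c)) (P (b, d)))
        (tens (deconcatenation u) (deconcatenation v))) =
    conv f g u * conv f g v"
proof -
  have "lin_form (\<lambda>(a, b). f a * g b)
      (lin (\<lambda>((a, b), (c, d)). tens (P (a, c)) (P (b, d)))
        (tens (deconcatenation u) (deconcatenation v))) =
    (\<Sum>i\<le>length u. \<Sum>j\<le>length v.
      lin_form f (P (take i u, take j v)) * lin_form g (P (drop i u, drop j v)))"
    by (simp add: lin_form_lin lin_form_tens lin_form_deconcatenation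
        lin_form_fun_mult lin_form_fun_mult_right case_prod_unfold)
  also have "\<dots> = (\<Sum>i\<le>length u. \<Sum>j\<le>length v.
      (f (take i u) * g (drop i u)) * (f (take j v) * g (drop j v)))"
    using assms generic_take_drop[OF assms(3)]
    by (intro sum.cong refl) (auto simp: multiplicative_def)
  also have "\<dots> = conv f g u * conv f g v"
    by (simp add: conv_def sum_product)
  finally show ?thesis .
qed

lemma multiplicative_nested: "multiplicative (nested E xs)"
  by (simp add: multiplicative_def nested_mult)

text \<open>
  Applying \<open>S xs \<otimes> S ys\<close> to a deconcatenation amounts to applying \<open>S (xs @ ys)\<close>, so on both sides
  the result is \<open>S (xs @ ys) u \<cdot> S (xs @ ys) v\<close>.
\<close>

lemma deconcatenation_mult:
  assumes "generic [u, v]"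
  shows "lin deconcatenation (P (u, v)) =
    lin (\<lambda>((a, b), (c, d)). tens (P (a, c)) (P (b, d)))
      (tens (deconcatenation u) (deconcatenation v))"
proof (rule eq_pairI)
  fix xs ys
  have "lin_form (\<lambda>(a, b). nested E xs a * nested E ys b) (lin deconcatenation (P (u, v))) =
        nested E (xs @ ys) u * nested E (xs @ ys) v"
    by (simp add: lin_form_lin nested_append nested_mult assms flip: conv_eq_lin_form)
      (simp add: nested_mult[OF assms] flip: nested_append)
  then show "lin_form (\<lambda>(a, b). nested E xs a * nested E ys b) (lin deconcatenation (P (u, v))) =
      lin_form (\<lambda>(a, b). nested E xs a * nested E ys b)
        (lin (\<lambda>((a, b), (c, d)). tens (P (a, c)) (P (b, d)))
          (tens (deconcatenation u) (deconcatenation v)))"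
    using tensor_square_conv[OF multiplicative_nested multiplicative_nested assms]
    by (simp add: nested_append)
qed

lemma multiplicative_conv:
  assumes "multiplicative f" "multiplicative g"
  shows "multiplicative (conv f g)"
  unfolding multiplicative_def
proof (intro allI impI)
  fix u v assume "generic [u, v]"
  then have "lin_form (\<lambda>(a, b). f a * g b) (lin deconcatenation (P (u, v))) =
      conv f g u * conv f g v"
    using tensor_square_conv[OF assms] deconcatenation_mult by simp
  then show "lin_form (conv f g) (P (u, v)) = conv f g u * conv f g v"
    by (simp add: lin_form_lin flip: conv_eq_lin_form)
qed

lemma multiplicative_counit: "multiplicative counit"
  using multiplicative_nested[of "[]"] by (simp add: nested_def conv_list_Nil)

lemma multiplicative_conv_list:
  "(\<And>x. multiplicative (f x)) \<Longrightarrow> multiplicative (conv_list f xs)"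
  by (induction xs)
    (simp_all only: conv_list_Nil conv_list_Cons multiplicative_counit multiplicative_conv)

lemma mult_assoc:
  assumes "generic [u, v, w]"
  shows "lin P (tens (P (u, v)) (basis w)) = lin P (tens (basis u) (P (v, w)))"
proof (rule eqI)
  fix xs
  have gen: "generic [u, v]" "generic [v, w]"
    using assms by (auto simp: generic_def)
  have "lin_form (nested E xs) (lin P (tens (P (u, v)) (basis w))) =
        lin_form (\<lambda>a. nested E xs w * nested E xs a) (P (u, v))"
    unfolding lin_form_lin lin_form_tens
  proof (rule lin_form_cong)
    fix a assume "a \<in> keys (P (u, v))"
    then have "generic [a, w]"
      using keys_P[OF gen(1)] assms by (fastforce simp: generic_def)
    then show "lin_form (\<lambda>j. lin_form (nested E xs) (P (a, j))) (basis w) =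
        nested E xs w * nested E xs a"
      by (simp add: nested_mult)
  qed
  moreover have "lin_form (nested E xs) (lin P (tens (basis u) (P (v, w)))) =
        lin_form (\<lambda>a. nested E xs u * nested E xs a) (P (v, w))"
    unfolding lin_form_lin lin_form_tens lin_form_basis
  proof (rule lin_form_cong)
    fix a assume "a \<in> keys (P (v, w))"
    then have "generic [u, a]"
      using keys_P[OF gen(2)] assms by (fastforce simp: generic_def)
    then show "lin_form (nested E xs) (P (u, a)) = nested E xs u * nested E xs a"
      by (simp add: nested_mult)
  qed
  ultimately show "lin_form (nested E xs) (lin P (tens (P (u, v)) (basis w))) =
      lin_form (nested E xs) (lin P (tens (basis u) (P (v, w))))"
    by (simp only: lin_form_fun_mult nested_mult[OF gen(1)] nested_mult[OF gen(2)])
      (simp only: mult_ac)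
qed


lemma is_standard_gen_bialgebra:
  "is_standard_gen_bialgebra length
     \<lparr>index = index Tg, label = label Tg, eta = basis [], eps = counit,
       mult = P, comult = deconcatenation\<rparr>"
  (is "is_standard_gen_bialgebra length ?H")
proof -
  have label: "label Tg w = [w]" and idx: "w \<in> index Tg \<longleftrightarrow> generic [w]" for w
    by (simp_all add: Tg_def)
  have tensor_index: "(u, v) \<in> index (gen_tensor ?H ?H) \<longleftrightarrow> generic [u, v]" for u v
    by (auto simp: gen_tensor_def Tg_def generic_def)
  have tensor_all: "(\<forall>x\<in>index (gen_tensor ?H ?H). Q x) \<longleftrightarrow> (\<forall>u v. generic [u, v] \<longrightarrow> Q (u, v))" for Q
    by (auto simp: tensor_index)
  have tensor_label: "label (gen_tensor ?H ?H) (u, v) = [u, v]" for u v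
    by (simp add: gen_tensor_def Tg_def)
  have generic_keys: "generic [w] \<and> set w \<subseteq> set u \<union> set v"
    if "generic [u, v]" "w \<in> keys (P (u, v))" for u v w
    using keys_P[OF that] that(1) by (auto simp: generic_def)
  have generic_cut: "generic [take i w, drop i w]" if "generic [w]" for i w
    using that by (metis append_take_drop_id concat.simps generic_def append_Nil2)
  have mult_degree: "0 < length w \<and> length w \<le> length u + length v"
    if gen: "generic [u, v]" and pos: "0 < length u" "0 < length v" and w: "w \<in> keys (P (u, v))" for u v w
  proof
    have "lookup (P (u, v)) [] = lin_form counit (P (u, v))"
      by (rule lookup_eq_lin_form)
    also have "\<dots> = 0"
      using multiplicative_counit gen pos by (auto simp: multiplicative_def)
    finally show "0 < length w"
      using w by (auto simp: in_keys_iff)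
    have "length w = card (set w)"
      using keys_P[OF gen w] by (simp add: distinct_card)
    also have "\<dots> \<le> card (set u \<union> set v)"
      using keys_P[OF gen w] by (intro card_mono) auto
    also have "\<dots> \<le> length u + length v"
      using card_Un_le[of "set u" "set v"] card_length[of u] card_length[of v] by linarith
    finally show "length w \<le> length u + length v" .
  qed
  have "is_gen_object ?H"
    by (simp add: is_gen_object_def Tg_def)
  moreover have "gen_hom gen_unit ?H (\<lambda>_. eta ?H)"
    by (auto simp: gen_hom_def gen_unit_def Tg_def generic_def intro: gen_arrowI)
  moreover have "gen_hom ?H gen_unit (\<lambda>i. Poly_Mapping.single () (eps ?H i))"
    by (auto simp: gen_hom_def gen_unit_def Tg_def generic_def intro: gen_arrowI split: if_splits)
  moreover have "gen_hom (gen_tensor ?H ?H) ?H P"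
  proof -
    have "w \<in> index ?H \<and> gen_arrow [u, v] [w]"
      if "generic [u, v]" "w \<in> keys (P (u, v))" for u v w
      using generic_keys[OF that] by (auto simp: idx generic_def intro!: gen_arrowI)
    then show ?thesis
      by (auto simp: gen_hom_def tensor_index tensor_label label)
  qed
  moreover have "gen_hom ?H (gen_tensor ?H ?H) (deconcatenation :: _ \<Rightarrow> _ \<Rightarrow>\<^sub>0 'k)"
  proof -
    have "(u, v) \<in> index (gen_tensor ?H ?H) \<and> gen_arrow [w] [u, v]"
      if w: "generic [w]" and uv: "(u, v) \<in> keys (deconcatenation w :: _ \<Rightarrow>\<^sub>0 'k)" for u v w
    proof -
      obtain i where "u = take i w" "v = drop i w"
        using uv keys_deconcatenation[of w] by auto
      then show ?thesis
        using generic_cut[OF w] by (simp add: tensor_index gen_arrow.regroup)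
    qed
    then show ?thesis
      by (auto simp: gen_hom_def tensor_label label idx)
  qed
  moreover have "lin P (tens (P (u, v)) (basis w)) = lin P (tens (basis u) (P (v, w)))"
    if "generic [u, v, w]" for u v w
    using that by (rule mult_assoc)
  moreover have "lin (\<lambda>(a, b). lin (\<lambda>(c, d). basis (c, d, b)) (deconcatenation a)) (deconcatenation w) =
        lin (\<lambda>(a, b). lin (\<lambda>(c, d). basis (a, c, d)) (deconcatenation b))
          (deconcatenation w :: _ \<Rightarrow>\<^sub>0 'k)" for w
    using sum_cuts_coassoc[of "\<lambda>a b c. basis (a, b, c) :: _ \<Rightarrow>\<^sub>0 'k" w]
    by (simp add: lin_deconcatenation)
  moreover have "lin (\<lambda>(a, b). scale (counit a) (basis b)) (deconcatenation w) = (basis w :: _ \<Rightarrow>\<^sub>0 'k)"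
    "lin (\<lambda>(a, b). scale (counit b) (basis a)) (deconcatenation w) = (basis w :: _ \<Rightarrow>\<^sub>0 'k)" for w
  proof -
    have "lin_form (nested E xs) (lin (\<lambda>(a, b). scale (counit a) (basis b)) (deconcatenation w)) =
          conv counit (nested E xs) w"
      "lin_form (nested E xs) (lin (\<lambda>(a, b). scale (counit b) (basis a)) (deconcatenation w)) =
          conv (nested E xs) counit w" for xs
      unfolding conv_eq_lin_form lin_form_lin
      by (simp_all only: case_prod_unfold lin_form_scale lin_form_basis mult.commute)
    then show "lin (\<lambda>(a, b). scale (counit a) (basis b)) (deconcatenation w) = (basis w :: _ \<Rightarrow>\<^sub>0 'k)"
      "lin (\<lambda>(a, b). scale (counit b) (basis a)) (deconcatenation w) = (basis w :: _ \<Rightarrow>\<^sub>0 'k)"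
      by (simp_all add: eqI)
  qed
  moreover have "lin deconcatenation (P (u, v)) =
      lin (\<lambda>((a, b), (c, d)). tens (P (a, c)) (P (b, d)))
        (tens (deconcatenation u) (deconcatenation v))" if "generic [u, v]" for u v
    using that by (rule deconcatenation_mult)
  moreover have "lin_form counit (P (u, v)) = counit u * counit v" if "generic [u, v]" for u v
    using multiplicative_counit that by (simp add: multiplicative_def)
  moreover have "lin deconcatenation (basis []) = tens (basis []) (basis [] :: _ \<Rightarrow>\<^sub>0 'k)"
    by (simp add: deconcatenation_def)
  ultimately have "is_gen_bialgebra ?H"
    unfolding is_gen_bialgebra_def
    by (simp add: label P_Nil_left P_Nil_right tensor_all)
  moreover have "{w \<in> index ?H. length w = 0} = {[]}" "[] \<in> index ?H"
    by (auto simp: idx generic_def)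
  moreover have "length u + length v = length w"
    if "(u, v) \<in> keys (deconcatenation w :: _ \<Rightarrow>\<^sub>0 'k)" for u v w
    using that keys_deconcatenation[of w] by auto
  ultimately show ?thesis
    unfolding is_standard_gen_bialgebra_def tensor_all
    using mult_degree by (auto simp: label)
qed

end


section \<open>The quasi-shuffle and shuffle products\<close>

text \<open>
  The letter \<open>n\<close> as the rational function \<open>1 / (z - n)\<close>, evaluated at the negative integers
  \<open>z = - (x + 1)\<close>: these avoid the poles at all letters, and there are infinitely many of them because
  the characteristic is zero.
\<close>

definition pole :: "nat \<Rightarrow> nat \<Rightarrow> 'k::field_char_0" where
  "pole x n = 1 / (- of_nat (Suc x) - of_nat n)"

lemma pole_denominator: "- of_nat (Suc x) - of_nat n \<noteq> (0::'k::field_char_0)"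
proof -
  have "- of_nat (Suc x) - of_nat n = (- of_nat (Suc (x + n)) :: 'k)"
    by simp
  then show ?thesis
    by (metis neg_equal_0_iff_equal of_nat_eq_0_iff nat.distinct(2))
qed

lemma pole_mult:
  assumes "n \<noteq> m"
  shows "pole x n * pole x m = 1 / (of_nat n - of_nat m) * (pole x n - pole x m :: 'k::field_char_0)"
proof -
  define X where "X = (- of_nat (Suc x) :: 'k)"
  have nz: "X - of_nat n \<noteq> 0" "X - of_nat m \<noteq> 0"
    using pole_denominator[where 'k='k] by (auto simp: X_def simp del: of_nat_Suc)
  have "(of_nat n - of_nat m :: 'k) \<noteq> 0"
    using assms by simp
  with nz show ?thesis
    unfolding pole_def X_def[symmetric] by (simp add: divide_simps)
qed

text \<open>
  Clearing denominators turns a vanishing combination of the functions \<open>1 / (z - n)\<close> into a polynomial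
  with infinitely many roots, whose value at a letter \<open>n\<close> is a nonzero multiple of the coefficient of
  \<open>n\<close>.
\<close>

lemma pole_separating:
  fixes q :: "nat \<Rightarrow>\<^sub>0 'k::field_char_0"
  assumes "\<And>x. lin_form (pole x) q = 0"
  shows "q = 0"
proof (rule ccontr)
  assume "q \<noteq> 0"
  then obtain n where n: "n \<in> keys q"
    by (metis ex_in_conv keys_eq_empty)
  define F where "F = (\<Sum>n\<in>keys q. smult (lookup q n) (\<Prod>m\<in>keys q - {n}. [:- of_nat m, 1:]))"
  have "poly F (- of_nat (Suc x)) = 0" for x
  proof -
    define X where "X = (- of_nat (Suc x) :: 'k)"
    have nz: "X - of_nat m \<noteq> 0" for m
      using pole_denominator[of x m, where 'k='k] by (simp add: X_def)
    have "poly F X = (\<Sum>n\<in>keys q. lookup q n * (\<Prod>m\<in>keys q - {n}. X - of_nat m))"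
      by (simp add: F_def poly_sum poly_prod)
    also have "\<dots> = (\<Sum>n\<in>keys q. (\<Prod>m\<in>keys q. X - of_nat m) * (lookup q n * pole x n))"
    proof (rule sum.cong[OF refl])
      fix n assume "n \<in> keys q"
      then have "(\<Prod>m\<in>keys q. X - of_nat m) = (X - of_nat n) * (\<Prod>m\<in>keys q - {n}. X - of_nat m)"
        by (simp add: prod.remove)
      then show "lookup q n * (\<Prod>m\<in>keys q - {n}. X - of_nat m) =
          (\<Prod>m\<in>keys q. X - of_nat m) * (lookup q n * pole x n)"
        using nz[of n] unfolding pole_def X_def[symmetric] by simp
    qed
    also have "\<dots> = (\<Prod>m\<in>keys q. X - of_nat m) * lin_form (pole x) q"
      by (simp add: lin_form_def sum_distrib_left)
    finally show ?thesis
      by (simp add: assms X_def)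
  qed
  then have "range (\<lambda>x. - of_nat (Suc x)) \<subseteq> {z. poly F z = 0}"
    by blast
  moreover have "infinite (range (\<lambda>x. - of_nat (Suc x) :: 'k))"
    by (intro range_inj_infinite injI) (simp del: of_nat_Suc)
  ultimately have "F = 0"
    using poly_roots_finite finite_subset by blast
  moreover have "poly F (of_nat n) = lookup q n * (\<Prod>m\<in>keys q - {n}. of_nat n - of_nat m)"
  proof -
    have "(\<Sum>k\<in>keys q - {n}. lookup q k * (\<Prod>m\<in>keys q - {k}. of_nat n - of_nat m)) = 0"
      using n by (intro sum.neutral) auto
    then show ?thesis
      using n by (simp add: F_def poly_sum poly_prod sum.remove[of _ n])
  qed
  ultimately show False
    using n by (simp add: in_keys_iff)
qed

interpretation QSh: generic_quasi_shuffle
  "\<lambda>(u, v). qshuffle u v" "pole :: nat \<Rightarrow> nat \<Rightarrow> 'k::field_char_0" 1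
proof
  show "(case (u, []) of (u, v) \<Rightarrow> qshuffle u v) = basis u" for u
    by (cases u) auto
  show "q = 0" if "\<And>x. lin_form (pole x) q = 0" for q :: "nat \<Rightarrow>\<^sub>0 'k"
    using that by (rule pole_separating)
qed (simp_all add: pole_mult)

definition letter_coordinate :: "nat \<Rightarrow> nat \<Rightarrow> 'k::field_char_0" where
  "letter_coordinate x n = (if n = x then 1 else 0)"

lemma shuffle_prod_Cons:
  assumes "n \<noteq> m"
  shows "shuffle_prod (n # u, m # v) =
    (cons_lin n (shuffle_prod (u, m # v)) + cons_lin m (shuffle_prod (n # u, v)) ::
      word \<Rightarrow>\<^sub>0 'k::comm_ring_1)"
proof -
  have image: "(\<Sum>w\<in>(#) a ` A. basis w) = (cons_lin a (\<Sum>w\<in>A. basis w) :: word \<Rightarrow>\<^sub>0 'k)"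
    for a and A :: "word set"
    by (simp add: sum.reindex cons_lin_def lin_sum)
  have "(\<Sum>w\<in>shuffles (n # u) (m # v). basis w) =
    ((\<Sum>w\<in>(#) n ` shuffles u (m # v). basis w) + (\<Sum>w\<in>(#) m ` shuffles (n # u) v. basis w) ::
      word \<Rightarrow>\<^sub>0 'k)"
    unfolding shuffles.simps using assms by (intro sum.union_disjoint) auto
  then show ?thesis
    by (simp add: shuffle_prod_def image)
qed

interpretation Sh: generic_quasi_shuffle
  shuffle_prod "letter_coordinate :: nat \<Rightarrow> nat \<Rightarrow> 'k::field_char_0" 0
proof
  show "q = 0" if "\<And>x. lin_form (letter_coordinate x) q = 0" for q :: "nat \<Rightarrow>\<^sub>0 'k"
    using that by (intro poly_mapping_eqI) (simp add: lookup_eq_lin_form letter_coordinate_def[abs_def])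
next
  fix n m u v assume "generic [n # u, m # v]"
  then have "n \<noteq> m" by (auto simp: generic_def)
  then show "(shuffle_prod (n # u, m # v) :: word \<Rightarrow>\<^sub>0 'k) =
    cons_lin n (shuffle_prod (u, m # v)) + cons_lin m (shuffle_prod (n # u, v)) +
    scale (0 / (of_nat n - of_nat m)) (cons_lin n (shuffle_prod (u, v)) - cons_lin m (shuffle_prod (u, v)))"
    by (simp add: shuffle_prod_Cons poly_mapping_eq_iff fun_eq_iff lookup_add)
qed (auto simp: shuffle_prod_def letter_coordinate_def)


section \<open>Quasi-shuffles counted by length\<close>

text \<open>
  This is \<open>\<Sum>\<^sub>r N\<^sub>r a\<^sub>r\<close>, where \<open>N\<^sub>r\<close> is the number of quasi-shuffles of length \<open>r\<close> of words of lengths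
  \<open>k\<close> and \<open>l\<close> (a merged pair of letters counting once), so that \<open>\<Sum>\<^sub>r N\<^sub>r\<close> is a Delannoy number. The
  recursion follows that of the product.
\<close>

fun delannoy_sum :: "(nat \<Rightarrow> 'a::comm_ring_1) \<Rightarrow> nat \<Rightarrow> nat \<Rightarrow> 'a" where
  "delannoy_sum a 0 l = a l"
| "delannoy_sum a (Suc k) 0 = a (Suc k)"
| "delannoy_sum a (Suc k) (Suc l) =
     delannoy_sum (\<lambda>r. a (Suc r)) k (Suc l) + delannoy_sum (\<lambda>r. a (Suc r)) (Suc k) l +
     delannoy_sum (\<lambda>r. a (Suc r)) k l"

lemma delannoy_sum_hom:
  assumes "\<And>x y. h (x + y) = h x + h y"
  shows "h (delannoy_sum a k l) = delannoy_sum (\<lambda>r. h (a r)) k l"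
  by (induction a k l rule: delannoy_sum.induct) (simp_all add: assms)

lemma delannoy_sum_add:
  "delannoy_sum (\<lambda>r. a r + b r) k l = delannoy_sum a k l + delannoy_sum b k l"
proof (induction a k l arbitrary: b rule: delannoy_sum.induct)
  case (3 a k l)
  show ?case
    unfolding delannoy_sum.simps "3.IH" by (simp only: add_ac)
qed simp_all

text \<open>
  Choosing a \<open>k\<close>-subset and an \<open>l\<close>-subset of \<open>z\<close> points is choosing their union together with the way
  in which they overlap, that is, a quasi-shuffle. Formally this is Pascal's rule in all three
  binomial coefficients.
\<close>

lemma delannoy_sum_gbinomial_of_nat:
  "delannoy_sum (\<lambda>r. of_nat z gchoose r) k l = (of_nat z gchoose k) * (of_nat z gchoose l :: 'k::field_char_0)"
proof (induction z arbitrary: k l)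
  case 0
  have "delannoy_sum (\<lambda>r. 0) k l = (0::'k)" for k l
    using delannoy_sum_hom[of "\<lambda>_. 0 :: 'k" "\<lambda>_. 0" k l] by simp
  then show ?case
    by (cases k; cases l) auto
next
  case (Suc z)
  have pascal: "(of_nat (Suc z) gchoose Suc r) = (of_nat z gchoose r) + (of_nat z gchoose Suc r :: 'k)" for r
    using gbinomial_Suc_Suc[of "of_nat z :: 'k" r] by (simp add: add.commute)
  show ?case
  proof (cases "k = 0 \<or> l = 0")
    case False
    then obtain k' l' where kl: "k = Suc k'" "l = Suc l'"
      by (auto simp: gr0_conv_Suc)
    let ?b = "\<lambda>r. of_nat z gchoose r :: 'k"
    have "delannoy_sum (\<lambda>r. of_nat (Suc z) gchoose r :: 'k) k l =
        delannoy_sum ?b k' (Suc l') + delannoy_sum ?b (Suc k') l' + delannoy_sum ?b k' l' +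
        delannoy_sum ?b (Suc k') (Suc l')"
      unfolding kl delannoy_sum.simps pascal delannoy_sum_add by (simp only: add_ac)
    also have "\<dots> = (of_nat (Suc z) gchoose k) * (of_nat (Suc z) gchoose l)"
      unfolding kl pascal Suc.IH by (simp only: ring_distribs add_ac)
    finally show ?thesis .
  qed (cases k; auto)
qed

text \<open>
  The binomial coefficient \<open>z choose r\<close> as a polynomial in \<open>z\<close>; this makes the coefficient of \<open>z\<close>
  available.
\<close>

fun binomial_poly :: "nat \<Rightarrow> 'k::field_char_0 poly" where
  "binomial_poly 0 = 1"
| "binomial_poly (Suc r) = smult (1 / of_nat (Suc r)) (binomial_poly r * [:- of_nat r, 1:])"

lemma poly_binomial_poly: "poly (binomial_poly r) z = z gchoose r"
proof (induction r)
  case (Suc r)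
  show ?case
    using gbinomial_mult_1[of z r] Suc by (simp add: field_simps del: of_nat_Suc)
qed simp

text \<open>
  The coefficients of \<open>log (1 + t)\<close>. The value at \<open>0\<close> is \<open>0\<close>, by division by zero, as it should be.
\<close>

definition log_coeff :: "nat \<Rightarrow> 'k::field_char_0" where
  "log_coeff k = (- 1) ^ (k - 1) / of_nat k"

lemma coeff_binomial_poly:
  "coeff (binomial_poly r) 0 = (if r = 0 then 1 else 0 :: 'k::field_char_0)"
  "coeff (binomial_poly r) 1 = (log_coeff r :: 'k::field_char_0)"
proof -
  show 0: "coeff (binomial_poly r) 0 = (if r = 0 then 1 else 0 :: 'k)" for r
    by (induction r) auto
  show "coeff (binomial_poly r) 1 = (log_coeff r :: 'k)"
  proof (induction r)
    case (Suc r)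
    have "coeff (binomial_poly (Suc r) :: 'k poly) 1 =
        (coeff (binomial_poly r) 0 - of_nat r * log_coeff r) / of_nat (Suc r)"
      using Suc by (simp add: coeff_mult atMost_Suc field_simps)
    also have "\<dots> = log_coeff (Suc r)"
      by (cases r) (auto simp: 0 log_coeff_def simp del: of_nat_Suc)
    finally show ?case .
  qed (simp add: log_coeff_def)
qed

lemma delannoy_sum_binomial_poly:
  "delannoy_sum binomial_poly k l = binomial_poly k * (binomial_poly l :: 'k::field_char_0 poly)"
proof -
  let ?F = "delannoy_sum binomial_poly k l - binomial_poly k * (binomial_poly l :: 'k poly)"
  have "poly ?F (of_nat z) = 0" for z
    using delannoy_sum_gbinomial_of_nat[of z k l, where 'k='k]
    by (simp add: delannoy_sum_hom[of "\<lambda>p. poly p _"] poly_binomial_poly)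
  then have "range of_nat \<subseteq> {x. poly ?F x = 0}"
    by blast
  moreover have "infinite (range (of_nat :: nat \<Rightarrow> 'k))"
    by (intro range_inj_infinite inj_of_nat)
  ultimately have "?F = 0"
    using poly_roots_finite finite_subset by blast
  then show ?thesis by simp
qed

text \<open>
  Both factors of \<open>(z choose k) (z choose l)\<close> vanish at \<open>z = 0\<close>, so that the product has no linear
  term.
\<close>

lemma delannoy_sum_log_coeff:
  assumes "k > 0" "l > 0"
  shows "delannoy_sum log_coeff k l = (0 :: 'k::field_char_0)"
proof -
  have "delannoy_sum log_coeff k l = coeff (delannoy_sum binomial_poly k l :: 'k poly) 1"
    using delannoy_sum_hom[of "\<lambda>p :: 'k poly. coeff p 1" binomial_poly k l]
    by (simp add: coeff_binomial_poly flip: One_nat_def)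
  also have "\<dots> = 0"
    using assms by (simp add: delannoy_sum_binomial_poly coeff_mult coeff_binomial_poly atMost_Suc)
  finally show ?thesis .
qed

text \<open>
  Since \<open>pole x\<close> respects the merging of letters, weighting words by the product of the values of
  their letters makes all quasi-shuffles contribute equally; only their lengths still matter.
\<close>

lemma qshuffle_length_functional:
  assumes "generic [u, v]"
  shows "lin_form (\<lambda>w. a (length w) * prod_list (map (pole x) w)) (qshuffle u v) =
    delannoy_sum a (length u) (length v) * prod_list (map (pole x) u) * prod_list (map (pole x) v)"
  using assms
proof (induction u v arbitrary: a rule: qshuffle.induct)
  case (3 n u m v)
  define d :: 'a where "d = 1 / (of_nat n - of_nat m)"
  have gen: "n \<noteq> m" "generic [u, m # v]" "generic [n # u, v]" "generic [u, v]"
    using "3.prems" by (auto simp: generic_def)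
  have d: "d * (pole x n - pole x m) = pole x n * pole x m"
    using pole_mult[OF gen(1), of x, where 'k='a] by (simp add: d_def)
  define L where
    "L p = lin_form (\<lambda>w. a (Suc (length w)) * prod_list (map (pole x) w)) p" for p :: "word \<Rightarrow>\<^sub>0 'a"
  have "lin_form (\<lambda>w. a (length w) * prod_list (map (pole x) w)) (cons_lin k p) = pole x k * L p"
    for k p
    using lin_form_fun_mult[of "pole x k" "\<lambda>w. a (Suc (length w)) * prod_list (map (pole x) w)" p]
    by (simp add: L_def lin_form_cons_lin mult.left_commute)
  then have "lin_form (\<lambda>w. a (length w) * prod_list (map (pole x) w)) (qshuffle (n # u) (m # v)) =
      pole x n * L (qshuffle u (m # v)) + pole x m * L (qshuffle (n # u) v) +
      d * (pole x n - pole x m) * L (qshuffle u v)"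
    by (simp add: lin_form_add lin_form_diff lin_form_scale algebra_simps flip: d_def)
  then show ?case
    unfolding d L_def
      "3.IH"(1)[OF gen(2), of "\<lambda>r. a (Suc r)"] "3.IH"(2)[OF gen(3), of "\<lambda>r. a (Suc r)"]
      "3.IH"(3)[OF gen(4), of "\<lambda>r. a (Suc r)"]
    by (simp add: algebra_simps)
qed simp_all


section \<open>The recursion for \<open>psi\<close>\<close>

definition log_block :: "word \<Rightarrow> (word \<Rightarrow>\<^sub>0 'k::field_char_0)" where
  "log_block v = scale (log_coeff (length v)) (block_Q v)"

text \<open>
  Multiplying the expansion for \<open>A\<close> by \<open>1 / (z - f c)\<close> and splitting
  \<open>1 / ((z - f c) (z - f a))\<close> gives the right terms for \<open>a \<in> A\<close>. The remaining multiple of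
  \<open>1 / (z - f c)\<close> is again an expansion for \<open>A\<close>, this time at the point \<open>f c\<close>.
\<close>

lemma partial_fractions:
  fixes f :: "'a \<Rightarrow> 'k::field"
  assumes "finite A" "A \<noteq> {}" "inj_on f A" "z \<notin> f ` A"
  shows "(\<Sum>a\<in>A. 1 / (\<Prod>b\<in>A - {a}. f a - f b) * (1 / (z - f a))) = (\<Prod>a\<in>A. 1 / (z - f a))"
  using assms
proof (induction A arbitrary: z rule: finite_ne_induct)
  case (insert c A)
  define W where "W a = 1 / (\<Prod>b\<in>A - {a}. f a - f b)" for a
  have fc: "f c \<notin> f ` A" and inj: "inj_on f A" and zA: "z \<notin> f ` A" and zc: "z \<noteq> f c"
    using insert.prems insert.hyps by auto
  have step: "1 / (\<Prod>b\<in>insert c A - {a}. f a - f b) * (1 / (z - f a)) =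
      1 / (z - f c) * (W a * (1 / (z - f a)) - W a * (1 / (f c - f a)))"
    if a: "a \<in> A" for a
  proof -
    have "insert c A - {a} = insert c (A - {a})"
      using a insert.hyps by auto
    then have "(\<Prod>b\<in>insert c A - {a}. f a - f b) = (f a - f c) * (\<Prod>b\<in>A - {a}. f a - f b)"
      using insert.hyps by simp
    then have W: "1 / (\<Prod>b\<in>insert c A - {a}. f a - f b) = W a * (1 / (f a - f c))"
      by (simp add: W_def)
    have "f a \<noteq> f c"
      using a fc by (metis imageI)
    then have "z - f a \<noteq> 0" "z - f c \<noteq> 0" "f a - f c \<noteq> 0" "f c - f a \<noteq> 0"
      using a zA zc by auto
    then have "1 / (f a - f c) * (1 / (z - f a)) = 1 / (z - f c) * (1 / (z - f a) - 1 / (f c - f a))"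
      by (simp add: divide_simps) (simp add: algebra_simps)
    then have "W a * (1 / (f a - f c) * (1 / (z - f a))) =
        W a * (1 / (z - f c) * (1 / (z - f a) - 1 / (f c - f a)))"
      by (rule arg_cong)
    then show ?thesis
      unfolding W by (simp only: mult.assoc right_diff_distrib mult.left_commute)
  qed
  have "(\<Sum>a\<in>insert c A. 1 / (\<Prod>b\<in>insert c A - {a}. f a - f b) * (1 / (z - f a))) =
      1 / (\<Prod>b\<in>A. f c - f b) * (1 / (z - f c)) +
      (\<Sum>a\<in>A. 1 / (\<Prod>b\<in>insert c A - {a}. f a - f b) * (1 / (z - f a)))"
    using insert.hyps by simp
  also have "(\<Sum>a\<in>A. 1 / (\<Prod>b\<in>insert c A - {a}. f a - f b) * (1 / (z - f a))) =
      (\<Sum>a\<in>A. 1 / (z - f c) * (W a * (1 / (z - f a)) - W a * (1 / (f c - f a))))"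
    by (rule sum.cong[OF refl step])
  also have "\<dots> = 1 / (z - f c) *
      ((\<Sum>a\<in>A. W a * (1 / (z - f a))) - (\<Sum>a\<in>A. W a * (1 / (f c - f a))))"
    by (simp only: sum_distrib_left sum_subtractf right_diff_distrib)
  also have "\<dots> = 1 / (z - f c) * ((\<Prod>a\<in>A. 1 / (z - f a)) - (\<Prod>a\<in>A. 1 / (f c - f a)))"
    unfolding W_def insert.IH[OF inj zA] insert.IH[OF inj fc] ..
  also have "1 / (\<Prod>b\<in>A. f c - f b) * (1 / (z - f c)) + \<dots> = (\<Prod>a\<in>insert c A. 1 / (z - f a))"
  proof -
    have "(\<Prod>a\<in>A. 1 / (f c - f a)) = 1 / (\<Prod>b\<in>A. f c - f b)"
      by (simp add: prod_dividef)
    moreover have "p * t + t * (q - p) = t * q" for p q t :: 'k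
      by (simp add: algebra_simps)
    ultimately show ?thesis
      by (simp only: prod.insert[OF insert.hyps(1) insert.hyps(3)])
  qed
  finally show ?case .
qed simp

lemma keys_log_block:
  assumes "w \<in> keys (log_block v :: word \<Rightarrow>\<^sub>0 'k::field_char_0)"
  shows "\<exists>n\<in>set v. w = [n]"
proof -
  have "w \<in> keys (block_Q v :: word \<Rightarrow>\<^sub>0 'k)"
    using assms unfolding log_block_def by (rule subsetD[OF keys_scale])
  then obtain j where j: "j < length v" and
    w: "w \<in> keys (scale (1 / (\<Prod>l\<in>{..<length v} - {j}. of_nat (v ! j) - of_nat (v ! l)))
                 (basis [v ! j]) :: word \<Rightarrow>\<^sub>0 'k)"
    unfolding block_Q_def by (auto dest: subsetD[OF keys_sum])
  from subsetD[OF keys_scale w] j show ?thesis by simp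
qed

lemma log_block_Nil [simp]: "log_block [] = 0"
  by (rule poly_mapping_eqI) (simp add: log_block_def block_Q_def)

lemma log_block_single: "log_block [n] = basis [n]"
  by (rule poly_mapping_eqI) (simp add: log_block_def block_Q_def log_coeff_def lookup_single)

text \<open>
  \<open>block_Q v\<close> is the partial fraction expansion of the product of the functions \<open>1 / (z - n)\<close> over
  the letters \<open>n\<close> of \<open>v\<close>.
\<close>

lemma pole_log_block:
  assumes "distinct v"
  shows "lin_form (\<lambda>w. pole x (hd w)) (log_block v) =
    log_coeff (length v) * prod_list (map (pole x) v :: 'k::field_char_0 list)"
proof -
  define z where "z = (- of_nat (Suc x) :: 'k)"
  have pole: "pole x n = 1 / (z - of_nat n)" for n
    by (simp add: pole_def z_def)
  have "inj_on (\<lambda>j. of_nat (v ! j) :: 'k) {..<length v}"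
    using assms by (auto simp: inj_on_def nth_eq_iff_index_eq)
  moreover have "z \<notin> (\<lambda>j. of_nat (v ! j)) ` {..<length v}"
    using pole_denominator[of x _, where 'k='k] by (auto simp: z_def simp del: of_nat_Suc)
  ultimately have "lin_form (\<lambda>w. pole x (hd w)) (block_Q v) = (\<Prod>j<length v. pole x (v ! j) :: 'k)"
    if "v \<noteq> []"
    using partial_fractions[of "{..<length v}" "\<lambda>j. of_nat (v ! j) :: 'k" z] that
    by (simp add: block_Q_def lin_form_sum lin_form_scale pole lessThan_empty_iff)
  moreover have "(\<Prod>j<length v. pole x (v ! j) :: 'k) = prod_list (map (pole x) v)"
    by (simp add: prod.list_conv_set_nth atLeast0LessThan)
  ultimately show ?thesis
    by (cases "v = []") (auto simp: log_block_def lin_form_scale log_coeff_def)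
qed

lemma lin_form_conc: "lin_form f (conc p q) = lin_form (\<lambda>u. lin_form (\<lambda>v. f (u @ v)) q) p"
  by (simp add: conc_def lin_form_lin lin_form_tens)

lemma conc_scale_left: "conc (scale c p) q = scale c (conc p q)"
  by (rule lin_form_eqI) (simp add: lin_form_conc lin_form_scale)

lemma conc_scale_right: "conc p (scale c q) = scale c (conc p q)"
  by (rule lin_form_eqI) (simp add: lin_form_conc lin_form_scale lin_form_fun_mult)

lemma conc_add_right: "conc p (q + r) = conc p q + conc p r"
  by (rule lin_form_eqI) (simp add: lin_form_conc lin_form_add lin_form_fun_add)

lemma conc_zero_right [simp]: "conc p 0 = 0"
  by (rule lin_form_eqI) (simp add: lin_form_conc)

lemma conc_sum_right: "conc p (\<Sum>a\<in>A. q a) = (\<Sum>a\<in>A. conc p (q a))"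
  by (induction A rule: infinite_finite_induct) (auto simp: conc_add_right)

lemma keys_conc: "w \<in> keys (conc p q) \<Longrightarrow> \<exists>u\<in>keys p. \<exists>v\<in>keys q. w = u @ v"
  using keys_lin[of "\<lambda>(u, v). basis (u @ v)" "tens p q"] keys_tens[of p q]
  by (force simp: conc_def)

lemma compositions_Suc:
  assumes "k > 0"
  shows "compositions k = (\<Union>i\<in>{1..k}. (#) i ` compositions (k - i))"
proof
  show "compositions k \<subseteq> (\<Union>i\<in>{1..k}. (#) i ` compositions (k - i))"
  proof
    fix \<mu> assume "\<mu> \<in> compositions k"
    with assms show "\<mu> \<in> (\<Union>i\<in>{1..k}. (#) i ` compositions (k - i))"
      by (cases \<mu>) (auto simp: compositions_def intro!: bexI[of _ "hd \<mu>"])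
  qed
qed (auto simp: compositions_def)

lemma length_composition: "\<mu> \<in> compositions k \<Longrightarrow> length \<mu> \<le> k"
proof -
  have "length \<mu> \<le> sum_list \<mu>" if "\<forall>m\<in>set \<mu>. 0 < m" for \<mu> :: "nat list"
    using that by (induction \<mu>) force+
  then show "\<mu> \<in> compositions k \<Longrightarrow> length \<mu> \<le> k"
    by (auto simp: compositions_def)
qed

definition conc_blocks :: "nat list \<Rightarrow> word \<Rightarrow> (word \<Rightarrow>\<^sub>0 'k::field_char_0)" where
  "conc_blocks \<mu> w = foldr conc
     (map (\<lambda>s. block_Q (take (\<mu> ! s) (drop (sum_list (take s \<mu>)) w))) [0..<length \<mu>]) (basis [])"

lemma conc_blocks_Cons:
  "conc_blocks (i # \<mu>) w = conc (block_Q (take i w)) (conc_blocks \<mu> (drop i w))"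
proof -
  have "[0..<length (i # \<mu>)] = 0 # map Suc [0..<length \<mu>]"
    by (simp add: upt_conv_Cons map_Suc_upt del: upt_Suc)
  then show ?thesis
    by (simp add: conc_blocks_def add.commute o_def del: upt_Suc)
qed

lemma psi_eq_sum:
  "psi w = (\<Sum>\<mu>\<in>compositions (length w).
     scale ((- 1) ^ (length w - length \<mu>) / of_nat (prod_list \<mu>)) (conc_blocks \<mu> w))"
proof (cases "w = []")
  case True
  have "compositions 0 = {[]}"
    using length_composition[of _ 0] by (auto simp: compositions_def)
  with True show ?thesis
    by (simp add: psi_def conc_blocks_def poly_mapping_eq_iff fun_eq_iff)
qed (simp add: psi_def conc_blocks_def)

text \<open>
  Splitting off the first part \<open>i\<close> of a composition of \<open>k\<close>. The sign distributes because
  \<open>k - (r + 1) = (i - 1) + (k - i - r)\<close> for the \<open>r\<close> parts that are left; here \<open>r \<le> k - i\<close> guards the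
  subtractions.
\<close>

lemma psi_rec:
  assumes "w \<noteq> []"
  shows "psi w = (\<Sum>i\<in>{1..length w}. conc (log_block (take i w)) (psi (drop i w)) ::
    word \<Rightarrow>\<^sub>0 'k::field_char_0)"
proof -
  define k where "k = length w"
  define G where "G \<mu> = scale ((- 1) ^ (k - length \<mu>) / of_nat (prod_list \<mu>)) (conc_blocks \<mu> w :: word \<Rightarrow>\<^sub>0 'k)"
    for \<mu> :: "nat list"
  have k: "k > 0"
    using assms by (simp add: k_def)
  have "psi w = (\<Sum>\<mu>\<in>(\<Union>i\<in>{1..k}. (#) i ` compositions (k - i)). G \<mu>)"
    using compositions_Suc[OF k] by (simp only: psi_eq_sum[of w] G_def k_def)
  also have "\<dots> = (\<Sum>i\<in>{1..k}. \<Sum>\<mu>\<in>(#) i ` compositions (k - i). G \<mu>)"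
    by (rule sum.UNION_disjoint) (auto simp: finite_compositions)
  also have "\<dots> = (\<Sum>i\<in>{1..k}. \<Sum>\<mu>\<in>compositions (k - i). G (i # \<mu>))"
    by (simp add: sum.reindex)
  also have "\<dots> = (\<Sum>i\<in>{1..k}. conc (log_block (take i w)) (psi (drop i w)))"
  proof (rule sum.cong[OF refl])
    fix i assume i: "i \<in> {1..k}"
    have "G (i # \<mu>) = conc (log_block (take i w))
        (scale ((- 1) ^ (k - i - length \<mu>) / of_nat (prod_list \<mu>)) (conc_blocks \<mu> (drop i w)))"
      if "\<mu> \<in> compositions (k - i)" for \<mu>
    proof -
      have "k - length (i # \<mu>) = (i - 1) + (k - i - length \<mu>)"
        using i length_composition[OF that] by auto
      then have "(- 1) ^ (k - length (i # \<mu>)) / of_nat (prod_list (i # \<mu>)) =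
          log_coeff i * ((- 1) ^ (k - i - length \<mu>) / of_nat (prod_list \<mu>) :: 'k)"
        by (simp only: power_add) (simp add: log_coeff_def)
      moreover have "length (take i w) = i"
        using i by (simp add: k_def)
      ultimately show ?thesis
        by (simp only: G_def conc_blocks_Cons log_block_def conc_scale_left conc_scale_right scale_scale
          mult.commute)
    qed
    then show "(\<Sum>\<mu>\<in>compositions (k - i). G (i # \<mu>)) = conc (log_block (take i w)) (psi (drop i w))"
      using i by (simp add: psi_eq_sum[of "drop i w"] conc_sum_right k_def)
  qed
  finally show ?thesis
    by (simp only: k_def)
qed


lemma keys_psi:
  "w' \<in> keys (psi w :: word \<Rightarrow>\<^sub>0 'k::field_char_0) \<Longrightarrow>
   length w' \<le> length w \<and> set w' \<subseteq> set w \<and> (distinct w \<longrightarrow> distinct w')"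
proof (induction w arbitrary: w' rule: length_induct)
  case (1 w)
  show ?case
  proof (cases "w = []")
    case False
    have "w' \<in> keys (\<Sum>i\<in>{1..length w}. conc (log_block (take i w)) (psi (drop i w)) :: word \<Rightarrow>\<^sub>0 'k)"
      using "1.prems" unfolding psi_rec[OF False] .
    from subsetD[OF keys_sum this] obtain i where i: "i \<in> {1..length w}"
      and "w' \<in> keys (conc (log_block (take i w)) (psi (drop i w)) :: word \<Rightarrow>\<^sub>0 'k)"
      by blast
    from keys_conc[OF this(2)] obtain u v where w': "w' = u @ v"
      and u: "u \<in> keys (log_block (take i w) :: word \<Rightarrow>\<^sub>0 'k)"
      and v: "v \<in> keys (psi (drop i w) :: word \<Rightarrow>\<^sub>0 'k)"
      by blast
    obtain n where n: "n \<in> set (take i w)" "u = [n]"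
      using keys_log_block[OF u] by blast
    have "length (drop i w) < length w"
      using i by auto
    with "1.IH" v have v': "length v \<le> length (drop i w)" "set v \<subseteq> set (drop i w)"
      "distinct (drop i w) \<longrightarrow> distinct v"
      by blast+
    have "n \<notin> set (drop i w)" if "distinct w"
      using that n(1) by (metis append_take_drop_id disjoint_iff distinct_append)
    then show ?thesis
      using i n v' set_take_subset[of i w] set_drop_subset[of i w] by (auto simp: w')
  qed (use "1.prems" in \<open>simp add: psi_def\<close>)
qed

lemma psi_Cons:
  "psi (n # v) = cons_lin n (psi v) +
     (\<Sum>i\<in>{2..length (n # v)}. conc (log_block (take i (n # v))) (psi (drop i (n # v))))"
proof -
  have "{1..length (n # v)} = insert 1 {2..length (n # v)}"
    by auto
  moreover have "conc (log_block (take 1 (n # v))) (psi (drop 1 (n # v))) = cons_lin n (psi v)"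
    by (rule lin_form_eqI) (simp add: lin_form_conc log_block_single lin_form_cons_lin)
  ultimately show ?thesis
    by (subst psi_rec) (simp_all add: sum.insert)
qed

text \<open>
  A block of length one is its own logarithm, and longer blocks contract at least two letters into
  one.
\<close>

lemma keys_psi_diff_basis:
  "w' \<in> keys (psi w - basis w :: word \<Rightarrow>\<^sub>0 'k::field_char_0) \<Longrightarrow> length w' < length w"
proof (induction w arbitrary: w')
  case Nil
  then show ?case by (simp add: psi_def)
next
  case (Cons n v)
  have "cons_lin n (psi v) - basis (n # v) = (cons_lin n (psi v - basis v) :: word \<Rightarrow>\<^sub>0 'k)"
    by (simp add: cons_lin_def lin_diff)
  then have split: "psi (n # v) - basis (n # v) = cons_lin n (psi v - basis v) +
      (\<Sum>i\<in>{2..length (n # v)}. conc (log_block (take i (n # v))) (psi (drop i (n # v))) ::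
        word \<Rightarrow>\<^sub>0 'k)"
    unfolding psi_Cons by (simp add: algebra_simps)
  have "w' \<in> keys (cons_lin n (psi v - basis v) :: word \<Rightarrow>\<^sub>0 'k) \<union>
      keys (\<Sum>i\<in>{2..length (n # v)}. conc (log_block (take i (n # v))) (psi (drop i (n # v))) ::
        word \<Rightarrow>\<^sub>0 'k)"
    using Cons.prems unfolding split by (rule subsetD[OF Poly_Mapping.keys_add])
  then show ?case
  proof
    assume "w' \<in> keys (cons_lin n (psi v - basis v) :: word \<Rightarrow>\<^sub>0 'k)"
    from keys_cons_lin[OF this] show ?thesis
      using Cons.IH by auto
  next
    assume "w' \<in> keys (\<Sum>i\<in>{2..length (n # v)}.
        conc (log_block (take i (n # v))) (psi (drop i (n # v))) :: word \<Rightarrow>\<^sub>0 'k)"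
    from subsetD[OF keys_sum this] obtain i where i: "i \<in> {2..length (n # v)}"
      and "w' \<in> keys (conc (log_block (take i (n # v))) (psi (drop i (n # v))) :: word \<Rightarrow>\<^sub>0 'k)"
      by blast
    from keys_conc[OF this(2)] obtain a b where w': "w' = a @ b"
      and a: "a \<in> keys (log_block (take i (n # v)) :: word \<Rightarrow>\<^sub>0 'k)"
      and b: "b \<in> keys (psi (drop i (n # v)) :: word \<Rightarrow>\<^sub>0 'k)"
      by blast
    show ?thesis
      using keys_log_block[OF a] keys_psi[OF b] i by (auto simp: w')
  qed
qed


section \<open>\<open>psi\<close> is a morphism of bialgebras\<close>

definition log_char :: "nat \<Rightarrow> word \<Rightarrow> 'k::field_char_0" where
  "log_char x u = (if u = [] then 1 else lookup (log_block u) [x])"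

lemma nested_conc_log_block:
  "lin_form (nested letter_coordinate (x # xs)) (conc (log_block u) p) =
   lin_form (nested letter_coordinate xs) (conc (log_block u) p) +
   lookup (log_block u) [x] * lin_form (nested letter_coordinate xs) p"
proof -
  let ?N = "nested letter_coordinate :: nat list \<Rightarrow> word \<Rightarrow> 'a"
  have "lin_form (?N (x # xs)) (conc (log_block u) p) =
      lin_form (\<lambda>w. lin_form (\<lambda>v. ?N xs (w @ v)) p + (if w = [x] then 1 else 0) * lin_form (?N xs) p)
        (log_block u)"
    unfolding lin_form_conc
  proof (rule lin_form_cong)
    fix w assume "w \<in> keys (log_block u :: word \<Rightarrow>\<^sub>0 'a)"
    then obtain n where "w = [n]"
      using keys_log_block by blast
    then show "lin_form (\<lambda>v. ?N (x # xs) (w @ v)) p =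
        lin_form (\<lambda>v. ?N xs (w @ v)) p + (if w = [x] then 1 else 0) * lin_form (?N xs) p"
      by (simp add: lin_form_fun_add lin_form_fun_mult letter_coordinate_def)
  qed
  then show ?thesis
    by (simp only: lin_form_fun_add lin_form_fun_mult_right lin_form_conc lookup_eq_lin_form[of "log_block u"])
qed

text \<open>
  In the recursion for \<open>psi\<close> each block becomes a single letter. The first point \<open>x\<close> therefore is
  either skipped or equal to the letter of the first block, which is what convolution with
  \<open>log_char x\<close> expresses: skipping is the cut after the empty prefix.
\<close>

lemma nested_psi: "lin_form (nested letter_coordinate xs) (psi w) = (conv_list log_char xs w :: 'k::field_char_0)"
proof (induction xs arbitrary: w)
  case Nil
  show ?case
  proof (cases "w = []")
    case False
    have "lin_form (nested letter_coordinate []) (conc (log_block u) p) = (0::'k)" for u p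
    proof -
      have "lin_form (\<lambda>w. lin_form (\<lambda>v. nested letter_coordinate [] (w @ v)) p) (log_block u) =
          lin_form (\<lambda>w. 0) (log_block u :: word \<Rightarrow>\<^sub>0 'k)"
        by (rule lin_form_cong) (use keys_log_block in \<open>force simp: nested_Nil\<close>)
      then show ?thesis by (simp add: lin_form_conc)
    qed
    with False show ?thesis
      by (simp add: psi_rec lin_form_sum conv_list_Nil)
  qed (simp add: psi_def conv_list_Nil)
next
  case (Cons x xs)
  show ?case
  proof (cases "w = []")
    case True
    have "conv_list log_char ys [] = (1 :: 'k)" for ys
      by (induction ys) (simp_all add: conv_list_Nil conv_list_Cons log_char_def)
    with True show ?thesis by (simp add: psi_def)
  next
    case False
    have "lin_form (nested letter_coordinate (x # xs)) (psi w) =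
        lin_form (nested letter_coordinate xs) (psi w) +
        (\<Sum>i\<in>{1..length w}. lookup (log_block (take i w)) [x] * conv_list log_char xs (drop i w) :: 'k)"
      by (simp add: psi_rec[OF False] lin_form_sum nested_conc_log_block sum.distrib Cons.IH)
    also have "(\<Sum>i\<in>{1..length w}. lookup (log_block (take i w)) [x] * conv_list log_char xs (drop i w)) =
        (\<Sum>i\<in>{1..length w}. log_char x (take i w) * conv_list log_char xs (drop i w) :: 'k)"
      using False by (intro sum.cong) (auto simp: log_char_def)
    also have "lin_form (nested letter_coordinate xs) (psi w) + \<dots> =
        log_char x (take 0 w) * conv_list log_char xs (drop 0 w) +
        (\<Sum>i\<in>{1..length w}. log_char x (take i w) * conv_list log_char xs (drop i w))"
      by (simp add: Cons.IH log_char_def[of x "[]"])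
    also have "\<dots> = conv (log_char x) (conv_list log_char xs) w"
      by (simp add: conv_def atMost_atLeast0 sum.atLeast_Suc_atMost)
    finally show ?thesis
      by (simp add: conv_list_Cons)
  qed
qed

text \<open>
  After evaluating letters by \<open>pole x\<close>, the sum of the log blocks is
  \<open>\<Sum>\<^sub>r N\<^sub>r (-1) ^ (r - 1) / r\<close> times a common factor, hence zero; and these evaluations separate
  the letters.
\<close>

lemma log_block_qshuffle:
  assumes "generic [u, v]" "u \<noteq> []" "v \<noteq> []"
  shows "lin log_block (qshuffle u v) = (0 :: word \<Rightarrow>\<^sub>0 'k::field_char_0)"
proof -
  define r where "r = (lin log_block (qshuffle u v) :: word \<Rightarrow>\<^sub>0 'k)"
  have single: "\<exists>n. w = [n]" if w: "w \<in> keys r" for w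
  proof -
    obtain u where "w \<in> keys (log_block u :: word \<Rightarrow>\<^sub>0 'k)"
      using subsetD[OF keys_lin w[unfolded r_def]] by blast
    from keys_log_block[OF this] show ?thesis by blast
  qed
  define q where "q = lin (\<lambda>w. basis (hd w)) r"
  have "lin_form (pole x) q = 0" for x
  proof -
    have "lin_form (pole x) q = lin_form (\<lambda>w. lin_form (\<lambda>w. pole x (hd w)) (log_block w)) (qshuffle u v :: word \<Rightarrow>\<^sub>0 'k)"
      by (simp add: q_def r_def lin_form_lin)
    also have "\<dots> = lin_form (\<lambda>w. log_coeff (length w) * prod_list (map (pole x) w)) (qshuffle u v)"
      using QSh.keys_P[of u v] assms(1) by (intro lin_form_cong pole_log_block) auto
    also have "\<dots> = 0"
      using assms by (simp add: qshuffle_length_functional delannoy_sum_log_coeff)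
    finally show ?thesis .
  qed
  then have "q = 0"
    by (rule pole_separating)
  have "lookup r w = 0" for w
  proof (cases "w \<in> keys r")
    case True
    then obtain n where w: "w = [n]"
      using single by blast
    have "lookup r w = lin_form (\<lambda>w'. lookup (basis (hd w')) n) r"
      unfolding lookup_eq_lin_form[of r]
      by (rule lin_form_cong) (use single in \<open>force simp: w lookup_single when_def\<close>)
    also have "\<dots> = lookup q n"
      by (simp add: q_def lookup_lin)
    finally show ?thesis
      using \<open>q = 0\<close> by simp
  qed (simp add: in_keys_iff)
  then show ?thesis
    unfolding r_def by (intro poly_mapping_eqI) simp
qed

text \<open>
  For nonempty words the left-hand side vanishes by the previous lemma, and the right-hand side
  because \<open>x\<close> is a letter of at most one of the two words.
\<close>

lemma multiplicative_log_char: "QSh.multiplicative (log_char x :: word \<Rightarrow> 'k::field_char_0)"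
  unfolding QSh.multiplicative_def
proof (intro allI impI)
  fix u v :: word assume gen: "generic [u, v]"
  have "lin_form (log_char x) (qshuffle u v) = log_char x u * (log_char x v :: 'k)"
  proof (cases "u = [] \<or> v = []")
    case True
    moreover have "qshuffle u [] = (basis u :: word \<Rightarrow>\<^sub>0 'k)"
      by (cases u) auto
    ultimately show ?thesis
      by (auto simp: log_char_def)
  next
    case False
    have "log_char x = (\<lambda>w. counit w + lookup (log_block w :: word \<Rightarrow>\<^sub>0 'k) [x])"
      by (auto simp: log_char_def)
    then have "lin_form (log_char x) (qshuffle u v) =
        lin_form counit (qshuffle u v) + lookup (lin log_block (qshuffle u v) :: word \<Rightarrow>\<^sub>0 'k) [x]"
      by (simp only: lin_form_fun_add lookup_lin)
    also have "\<dots> = 0"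
    proof -
      have "QSh.multiplicative (counit :: word \<Rightarrow> 'k)"
        by (rule QSh.multiplicative_counit)
      with gen False show ?thesis
        by (simp add: log_block_qshuffle QSh.multiplicative_def)
    qed
    also have "\<dots> = log_char x u * log_char x v"
    proof -
      have "lookup (log_block w :: word \<Rightarrow>\<^sub>0 'k) [x] = 0" if "x \<notin> set w" for w
        using keys_log_block[of "[x]" w, where 'k='k] that by (auto simp: in_keys_iff)
      moreover have "x \<notin> set u \<or> x \<notin> set v"
        using gen by (auto simp: generic_def)
      ultimately show ?thesis
        using False by (auto simp: log_char_def)
    qed
    finally show ?thesis .
  qed
  then show "lin_form (log_char x) (case (u, v) of (u, v) \<Rightarrow> qshuffle u v) = log_char x u * (log_char x v :: 'k)"
    by simp
qed

lemma psi_mult: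
  assumes "generic [u, v]"
  shows "lin psi (qshuffle u v) = (lin shuffle_prod (tens (psi u) (psi v)) :: word \<Rightarrow>\<^sub>0 'k::field_char_0)"
proof (rule Sh.eqI)
  fix xs
  let ?N = "nested letter_coordinate xs :: word \<Rightarrow> 'k"
  have "QSh.multiplicative (conv_list log_char xs :: word \<Rightarrow> 'k)"
    by (intro QSh.multiplicative_conv_list multiplicative_log_char)
  then have "lin_form ?N (lin psi (qshuffle u v)) = lin_form ?N (psi u) * lin_form ?N (psi v)"
    using assms by (simp add: lin_form_lin nested_psi QSh.multiplicative_def)
  also have "\<dots> = lin_form (\<lambda>(a, b). ?N a * ?N b) (tens (psi u) (psi v))"
    by (simp add: lin_form_tens_mult)
  also have "\<dots> = lin_form ?N (lin shuffle_prod (tens (psi u) (psi v)))"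
    unfolding lin_form_lin
  proof (rule lin_form_cong)
    fix ab assume ab: "ab \<in> keys (tens (psi u) (psi v) :: _ \<Rightarrow>\<^sub>0 'k)"
    obtain a b where [simp]: "ab = (a, b)" by fastforce
    have "a \<in> keys (psi u :: _ \<Rightarrow>\<^sub>0 'k)" "b \<in> keys (psi v :: _ \<Rightarrow>\<^sub>0 'k)"
      using subsetD[OF keys_tens ab] by auto
    from keys_psi[OF this(1)] keys_psi[OF this(2)] have "generic [a, b]"
      using assms by (auto simp: generic_def)
    then show "(case ab of (a, b) \<Rightarrow> ?N a * ?N b) = lin_form ?N (shuffle_prod ab)"
      by (simp add: Sh.nested_mult)
  qed
  finally show "lin_form ?N (lin psi (qshuffle u v)) =
      lin_form ?N (lin shuffle_prod (tens (psi u) (psi v)))" .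
qed

lemma psi_comult:
  "lin deconcatenation (psi w) =
   (lin (\<lambda>(a, b). tens (psi a) (psi b)) (deconcatenation w) :: _ \<Rightarrow>\<^sub>0 'k::field_char_0)"
proof (rule Sh.eq_pairI)
  fix xs ys
  let ?N = "nested letter_coordinate :: nat list \<Rightarrow> word \<Rightarrow> 'k"
  have "lin_form (\<lambda>(u, v). ?N xs u * ?N ys v) (lin deconcatenation (psi w)) =
      lin_form (?N (xs @ ys)) (psi w)"
    by (simp add: lin_form_lin nested_append flip: conv_eq_lin_form)
  also have "\<dots> = conv (conv_list log_char xs) (conv_list log_char ys) w"
    by (simp add: nested_psi conv_list_append)
  also have "\<dots> = lin_form (\<lambda>(u, v). ?N xs u * ?N ys v)
      (lin (\<lambda>(a, b). tens (psi a) (psi b)) (deconcatenation w))"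
    by (simp add: lin_form_lin lin_form_deconcatenation lin_form_tens_mult nested_psi conv_def)
  finally show "lin_form (\<lambda>(u, v). ?N xs u * ?N ys v) (lin deconcatenation (psi w)) =
      lin_form (\<lambda>(u, v). ?N xs u * ?N ys v)
        (lin (\<lambda>(a, b). tens (psi a) (psi b)) (deconcatenation w))" .
qed

section \<open>Inverting unitriangular maps\<close>

text \<open>
  The inverse is the geometric series in \<open>N = 1 - f\<close>. It is finite on each basis vector since \<open>N\<close>
  decreases \<open>d\<close>. The relation \<open>R\<close> records what \<open>f\<close> preserves and passes it on to the inverse.
\<close>

lemma unitriangular_inverse:
  fixes f :: "'i \<Rightarrow> ('i \<Rightarrow>\<^sub>0 'k::comm_ring_1)" and d :: "'i \<Rightarrow> nat"
  assumes keys_f: "\<And>i j. i \<in> I \<Longrightarrow> j \<in> keys (f i - basis i) \<Longrightarrow> j \<in> I \<and> R i j \<and> d j < d i"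
    and R: "reflp R" "transp R"
  obtains g where
    "\<And>i j. i \<in> I \<Longrightarrow> j \<in> keys (g i) \<Longrightarrow> j \<in> I \<and> R i j"
    "\<And>i. i \<in> I \<Longrightarrow> lin g (f i) = basis i"
    "\<And>i. i \<in> I \<Longrightarrow> lin f (g i) = basis i"
proof
  define N where "N i = basis i - f i" for i
  define pw where "pw m i = (lin N ^^ m) (basis i)" for m i
  define g where "g i = (\<Sum>m\<le>d i. pw m i)" for i
  have keys_N: "j \<in> I \<and> R i j \<and> d j < d i" if "i \<in> I" "j \<in> keys (N i)" for i j
    using keys_f[of i j] that by (auto simp: N_def in_keys_iff lookup_minus)
  have pw_Suc: "pw (Suc m) i = lin N (pw m i)" for m i
    by (simp add: pw_def)
  have lin_pw: "(lin N ^^ m) p = lin (pw m) p" for m p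
  proof (induction m)
    case (Suc m)
    then show ?case
      by (simp add: pw_Suc[abs_def] lin_lin)
  qed (simp add: pw_def[abs_def])
  have keys_pw: "j \<in> I \<and> R i j \<and> d j + m \<le> d i" if "i \<in> I" "j \<in> keys (pw m i)" for m i j
    using that
  proof (induction m arbitrary: j)
    case 0
    then show ?case
      using R(1) by (auto simp: pw_def reflp_def)
  next
    case (Suc m)
    from subsetD[OF keys_lin Suc.prems(2)[unfolded pw_Suc]]
    obtain k where "k \<in> keys (pw m i)" "j \<in> keys (N k)"
      by blast
    then show ?case
      using Suc.IH[of k] keys_N[of k j] Suc.prems(1) transpD[OF R(2), of i k j] by auto
  qed
  have pw_0: "pw m i = 0" if i: "i \<in> I" and m: "d i < m" for m i
  proof -
    have "keys (pw m i) = {}"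
      using keys_pw[OF i] m by fastforce
    then show ?thesis by simp
  qed
  have lin_f: "lin f p = p - lin N p" for p
    using lin_fun_diff[of basis N p] by (simp add: N_def)
  show "j \<in> I \<and> R i j" if i: "i \<in> I" and j: "j \<in> keys (g i)" for i j
  proof -
    from subsetD[OF keys_sum j[unfolded g_def]] obtain m where "j \<in> keys (pw m i)"
      by blast
    with keys_pw i show ?thesis by blast
  qed
  have telescope: "g i - (\<Sum>m\<le>d i. pw (Suc m) i) = basis i" if "i \<in> I" for i
  proof -
    have "g i - (\<Sum>m\<le>d i. pw (Suc m) i) = pw 0 i - pw (Suc (d i)) i"
      using sum_telescope[of "\<lambda>m. pw m i" "d i"] by (simp add: g_def sum_subtractf)
    then show ?thesis
      using pw_0[OF that, of "Suc (d i)"] by (simp add: pw_def)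
  qed
  show "lin f (g i) = basis i" if "i \<in> I" for i
    using telescope[OF that] by (simp add: lin_f g_def lin_sum pw_Suc sum_subtractf)
  show "lin g (f i) = basis i" if i: "i \<in> I" for i
  proof -
    have "lin g (N i) = lin (\<lambda>j. \<Sum>m\<le>d i. pw m j) (N i)"
    proof (rule lin_cong)
      fix j assume "j \<in> keys (N i)"
      then have "j \<in> I" "d j < d i"
        using keys_N[OF i] by auto
      then show "g j = (\<Sum>m\<le>d i. pw m j)"
        unfolding g_def by (intro sum.mono_neutral_left) (auto simp: pw_0)
    qed
    also have "\<dots> = (\<Sum>m\<le>d i. lin (pw m) (N i))"
      by (rule poly_mapping_eqI)
        (simp add: lookup_lin lookup_sum lin_form_def sum_distrib_left sum.swap[of _ "keys (N i)"])
    also have "\<dots> = (\<Sum>m\<le>d i. pw (Suc m) i)"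
      by (simp add: pw_def funpow_swap1 flip: lin_pw)
    finally have "lin g (N i) = (\<Sum>m\<le>d i. pw (Suc m) i)" .
    moreover have "f i = basis i - N i"
      by (simp add: N_def)
    ultimately show ?thesis
      using telescope[OF i] by (simp add: lin_diff)
  qed
qed

theorem corollary19:
  shows "is_standard_gen_bialgebra length (QShg :: (word, 'k::field_char_0) gen_bialgebra) \<and>
         is_standard_gen_bialgebra length (Shg :: (word, 'k) gen_bialgebra) \<and>
         is_gen_bialgebra_iso (QShg :: (word, 'k) gen_bialgebra) Shg psi"
proof (intro conjI)
  show "is_standard_gen_bialgebra length (QShg :: (word, 'k) gen_bialgebra)"
    unfolding QShg_def by (rule QSh.is_standard_gen_bialgebra)
  show "is_standard_gen_bialgebra length (Shg :: (word, 'k) gen_bialgebra)"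
    unfolding Shg_def by (rule Sh.is_standard_gen_bialgebra)
  have index: "index (QShg :: (word, 'k) gen_bialgebra) = {w. generic [w]}"
    "index (Shg :: (word, 'k) gen_bialgebra) = {w. generic [w]}"
    and label: "label (QShg :: (word, 'k) gen_bialgebra) = (\<lambda>w. [w])"
    "label (Shg :: (word, 'k) gen_bialgebra) = (\<lambda>w. [w])"
    by (simp_all add: QShg_def Shg_def Tg_def)
  \<comment> \<open>on generic words, the letters that occur decide whether there is an arrow\<close>
  define sub where "sub u v \<longleftrightarrow> set v \<subseteq> set u" for u v :: word
  have arrow: "gen_arrow [u] [v]" if "generic [v]" "sub u v" for u v
    using that by (auto simp: generic_def sub_def intro!: gen_arrowI)
  have keys_psi_generic: "v \<in> {w. generic [w]} \<and> sub w v"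
    if "w \<in> {w. generic [w]}" "v \<in> keys (psi w :: word \<Rightarrow>\<^sub>0 'k)" for v w
    using keys_psi[OF that(2)] that(1) by (auto simp: generic_def sub_def)
  have "v \<in> {w. generic [w]} \<and> sub w v \<and> length v < length w"
    if w: "w \<in> {w. generic [w]}" and v: "v \<in> keys (psi w - basis w :: word \<Rightarrow>\<^sub>0 'k)" for v w
  proof -
    have less: "length v < length w"
      by (rule keys_psi_diff_basis[OF v])
    then have "v \<in> keys (psi w :: word \<Rightarrow>\<^sub>0 'k)"
      using v by (auto simp: in_keys_iff lookup_minus lookup_single when_def split: if_splits)
    then show ?thesis
      using keys_psi_generic[OF w] less by blast
  qed
  moreover have "reflp sub" "transp sub"
    by (auto simp: sub_def reflp_def transp_def)
  ultimately obtain g :: "word \<Rightarrow> (word \<Rightarrow>\<^sub>0 'k)" where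
    g: "\<And>w v. w \<in> {w. generic [w]} \<Longrightarrow> v \<in> keys (g w) \<Longrightarrow> v \<in> {w. generic [w]} \<and> sub w v"
      "\<And>w. w \<in> {w. generic [w]} \<Longrightarrow> lin g (psi w) = basis w"
      "\<And>w. w \<in> {w. generic [w]} \<Longrightarrow> lin psi (g w) = basis w"
    by (rule unitriangular_inverse[where f = psi and d = length]) blast+
  have "gen_hom (QShg :: (word, 'k) gen_bialgebra) (Shg :: (word, 'k) gen_bialgebra)
    (psi :: word \<Rightarrow> (word \<Rightarrow>\<^sub>0 'k))"
    using keys_psi_generic arrow by (auto simp: gen_hom_def index label)
  moreover have "gen_hom (Shg :: (word, 'k) gen_bialgebra) (QShg :: (word, 'k) gen_bialgebra) g"
    using g(1) arrow by (auto simp: gen_hom_def index label)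
  moreover have "lin_form counit (psi w) = (counit w :: 'k)" for w
    using nested_psi[of "[]" w, where 'k='k] by (simp add: nested_def conv_list_Nil)
  moreover have "lin psi (eta (QShg :: (word, 'k) gen_bialgebra)) = eta (Shg :: (word, 'k) gen_bialgebra)"
    by (simp add: QShg_def Shg_def psi_def)
  moreover have "lin psi (gen_bialgebra.mult QShg (u, v)) =
      (lin (gen_bialgebra.mult Shg) (tens (psi u) (psi v)) :: word \<Rightarrow>\<^sub>0 'k)"
    if "(u, v) \<in> index (gen_tensor (QShg :: (word, 'k) gen_bialgebra) (QShg :: (word, 'k) gen_bialgebra))"
    for u v
  proof -
    have "generic [u, v]"
      using that by (auto simp: gen_tensor_def index label generic_def)
    then show ?thesis
      by (simp add: QShg_def Shg_def psi_mult)
  qed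
  moreover have "lin (comult Shg) (psi w) =
      (lin (\<lambda>(a, b). tens (psi a) (psi b)) (comult QShg w) :: word \<times> word \<Rightarrow>\<^sub>0 'k)" for w
    by (simp add: QShg_def Shg_def psi_comult)
  moreover have "eps (QShg :: (word, 'k) gen_bialgebra) = counit" "eps (Shg :: (word, 'k) gen_bialgebra) = counit"
    by (simp_all add: QShg_def Shg_def)
  ultimately show "is_gen_bialgebra_iso (QShg :: (word, 'k) gen_bialgebra) Shg psi"
    unfolding is_gen_bialgebra_iso_def using g(2,3)
    by (auto simp: index intro!: exI[of _ g])
qed

end
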